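(* Let $\mathbb{S}_1,\mathbb{S}_2,\mathbb{S}_3$ be Borel subsets of Polish spaces, and let $\Psi$ be a stochastic kernel on $\mathbb{S}_1\times\mathbb{S}_2$ given $\mathbb{S}_3$. The following conditions are equivalent: (a) the stochastic kernel $\Psi$ on $\mathbb{S}_1\times\mathbb{S}_2$ given $\mathbb{S}_3$ is semi-uniform Feller; (b) the stochastic kernel $\Psi$ on $\mathbb{S}_1\times\mathbb{S}_2$ given $\mathbb{S}_3$ is WTV-continuous; (c) if $s_3^{(n)}$ converges to $s_3$ in $\mathbb{S}_3$, then for each closed set $C$ in $\mathbb{S}_1$ $$\lim_{n\to\infty}\sup_{B\in\mathcal{B}(\mathbb{S}_2)}\left(\Psi(C\times B|s_3^{(n)})-\Psi(C\times B|s_3)\right)=0;$$ (d) if $s_3^{(n)}$ converges to $s_3$ in $\mathbb{S}_3$, then, for each $A\in\mathcal{B}(\mathbb{S}_1)$ such that $\Psi(\partial A,\mathbb{S}_2|s_3)=0$, $$\lim_{n\to\infty}\sup_{B\in\mathcal{B}(\mathbb{S}_2)}\left|\Psi(A\times B|s_3^{(n)})-\Psi(A\times B|s_3)\right|=0;$$ (e) if $s_3^{(n)}$ converges to $s_3$ in $\mathbb{S}_3$, then, for each nonnegative bounded lower semi-continuous function $f$ on $\mathbb{S}_1$, $$\liminf_{n\to\infty}\inf_{B\in\mathcal{B}(\mathbb{S}_2)}\left(\int_{\mathbb{S}_1}f(s_1)\,\Psi(ds_1,B|s_3^{(n)})-\int_{\mathbb{S}_1}f(s_1)\,\Psi(ds_1,B|s_3)\right)=0.$$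 Moreover, each of these conditions implies continuity in total variation of the marginal kernel $\Psi(\mathbb{S}_1,\,\cdot\,|\,\cdot\,)$ on $\mathbb{S}_2$ given $\mathbb{S}_3$.
   Context: A Polish space is a complete separable metric space. Borel subsets of Polish spaces are considered as metric spaces with the restricted metric. $\mathcal{B}(\mathbb{S})$ is the Borel $\sigma$-field and $\tau(\mathbb{S})$ the family of all open subsets of a metric space $\mathbb{S}$. For $A\subset\mathbb{S}_1$, $\partial A=\bar{A}\setminus A^o$ is the boundary of $A$ in $\mathbb{S}_1$ (closure minus interior). A stochastic kernel $\Phi$ on a metric space $\mathbb{S}$ given a metric space $\mathbb{S}'$ is a mapping $\Phi:\mathcal{B}(\mathbb{S})\times\mathbb{S}'\to[0,1]$ such that $\Phi(\,\cdot\,|s')$ is a probability measure on $\mathbb{S}$ for every $s'\in\mathbb{S}'$, and $\Phi(B|\,\cdot\,)$ is Borel-measurable for every $B\in\mathcal{B}(\mathbb{S})$. It is continuous in total variation if $\sup_{B\in\mathcal{B}(\mathbb{S})}|\Phi(B|s'^{(n)})-\Phi(B|s')|\to 0$ whenever $s'^{(n)}\to s'$ in $\mathbb{S}'$. For a stochastic kernel $\Psi$ on $\mathbb{S}_1\times\mathbb{S}_2$ given $\mathbb{S}_3$, write $\Psi(A,B|s_3):=\Psi(A\times B|s_3)$ for $A\in\mathcal{B}(\mathbb{S}_1)$, $B\in\mathcal{B}(\mathbb{S}_2)$, $s_3\in\mathbb{S}_3$. Thus $\Psi(ds_1,B|s_3)$ is the finite measure $A\mapsto\Psi(A\times B|s_3)$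 on $\mathbb{S}_1$, and $\Psi(\mathbb{S}_1,\,\cdot\,|\,\cdot\,)$ is the marginal kernel on $\mathbb{S}_2$ given $\mathbb{S}_3$. $\Psi$ is semi-uniform Feller if, for each sequence $s_3^{(n)}\to s_3$ in $\mathbb{S}_3$ and each bounded continuous function $f$ on $\mathbb{S}_1$, $$\lim_{n\to\infty}\sup_{B\in\mathcal{B}(\mathbb{S}_2)}\left|\int_{\mathbb{S}_1}f(s_1)\,\Psi(ds_1,B|s_3^{(n)})-\int_{\mathbb{S}_1}f(s_1)\,\Psi(ds_1,B|s_3)\right|=0.$$ A set $\mathtt{F}$ of real-valued functions on a metric space $\mathbb{S}$ is lower semi-equicontinuous on $\mathbb{S}$ if $\liminf_{s'\to s}\inf_{f\in\mathtt{F}}(f(s')-f(s))\ge 0$ for every $s\in\mathbb{S}$. $\Psi$ is WTV-continuous if for each $\mathcal{O}\in\tau(\mathbb{S}_1)$ the set of functions $\{s_3\mapsto\Psi(\mathcal{O}\times B|s_3)\,:\,B\in\mathcal{B}(\mathbb{S}_2)\}$ is lower semi-equicontinuous on $\mathbb{S}_3$. *)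

theory Defs
  imports "HOL-Probability.Probability"
begin

text \<open>
  Metric spaces \<open>S\<close> are subsets of a metric type with the restricted metric; topological notions
  on \<open>S\<close> are relative to \<^term>\<open>top_of_set S\<close>. The Borel field of the subspace \<open>S\<close> is the trace
  of the ambient one, as confirmed by the lemma below.
\<close>

abbreviation borel_on :: "'a::topological_space set \<Rightarrow> 'a measure" where
  "borel_on S \<equiv> restrict_space borel S"

lemma sets_borel_on: "sets (borel_on S) = sigma_sets S {U. openin (top_of_set S) U}"
proof -
  have "sets (borel_on S) = {(\<lambda>x. x) -` A \<inter> S | A. A \<in> sigma_sets UNIV {U. open U}}"
    by (auto simp: sets_restrict_space borel_def image_iff)
  also have "\<dots> = sigma_sets S {(\<lambda>x. x) -` U \<inter> S | U. U \<in> {U. open U}}"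
    by (rule sigma_sets_vimage_commute) simp
  also have "{(\<lambda>x. x) -` U \<inter> S | U. U \<in> {U. open U}} = {U. openin (top_of_set S) U}"
    by (auto simp: openin_open)
  finally show ?thesis .
qed

text \<open>A kernel is a measure-valued function, of which only the values on \<open>T\<close> matter.\<close>

definition stochastic_kernel ::
    "'a::topological_space set \<Rightarrow> 'b::topological_space set \<Rightarrow> ('b \<Rightarrow> 'a measure) \<Rightarrow> bool" where
  "stochastic_kernel S T \<Phi> \<longleftrightarrow>
     (\<forall>t\<in>T. prob_space (\<Phi> t) \<and> sets (\<Phi> t) = sets (borel_on S)) \<and>
     (\<forall>B\<in>sets (borel_on S). (\<lambda>t. measure (\<Phi> t) B) \<in> borel_measurable (borel_on T))"

lemma stochastic_kernel_iff_measurable: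
  "stochastic_kernel S T \<Phi> \<longleftrightarrow> \<Phi> \<in> measurable (borel_on T) (prob_algebra (borel_on S))"
proof
  assume K: "stochastic_kernel S T \<Phi>"
  show "\<Phi> \<in> measurable (borel_on T) (prob_algebra (borel_on S))"
  proof (rule measurable_prob_algebraI)
    show "prob_space (\<Phi> t)" if "t \<in> space (borel_on T)" for t
      using K that by (auto simp: stochastic_kernel_def space_restrict_space)
    show "\<Phi> \<in> measurable (borel_on T) (subprob_algebra (borel_on S))"
    proof (rule measurable_subprob_algebra)
      fix t assume "t \<in> space (borel_on T)"
      then have t: "prob_space (\<Phi> t)" "sets (\<Phi> t) = sets (borel_on S)"
        using K by (auto simp: stochastic_kernel_def space_restrict_space)
      show "subprob_space (\<Phi> t)" using t(1) by (rule prob_space_imp_subprob_space)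
      show "sets (\<Phi> t) = sets (borel_on S)" by (rule t(2))
    next
      fix B assume "B \<in> sets (borel_on S)"
      then have "(\<lambda>t. ennreal (measure (\<Phi> t) B)) \<in> borel_measurable (borel_on T)"
        using K by (auto simp: stochastic_kernel_def)
      moreover have "emeasure (\<Phi> t) B = ennreal (measure (\<Phi> t) B)" if "t \<in> space (borel_on T)" for t
      proof -
        interpret prob_space "\<Phi> t"
          using K that by (auto simp: stochastic_kernel_def space_restrict_space)
        show ?thesis by (rule emeasure_eq_measure)
      qed
      ultimately show "(\<lambda>t. emeasure (\<Phi> t) B) \<in> borel_measurable (borel_on T)"
        by (simp cong: measurable_cong)
    qed
  qed
next
  assume K: "\<Phi> \<in> measurable (borel_on T) (prob_algebra (borel_on S))"
  have "prob_space (\<Phi> t) \<and> sets (\<Phi> t) = sets (borel_on S)" if "t \<in> T" for t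
    using measurable_space[OF K, of t] that by (auto simp: space_prob_algebra space_restrict_space)
  moreover have "(\<lambda>t. measure (\<Phi> t) B) \<in> borel_measurable (borel_on T)"
    if "B \<in> sets (borel_on S)" for B
    using measurable_compose[OF measurable_prob_algebraD[OF K] measurable_measure_subprob_algebra[OF that]] .
  ultimately show "stochastic_kernel S T \<Phi>"
    by (simp add: stochastic_kernel_def)
qed

text \<open>
  In the suprema over real numbers below the supremum is over a nonempty bounded set (measures
  are probabilities and integrands bounded), so the conditionally complete \<open>SUP\<close> is meaningful.
\<close>

definition continuous_in_total_variation ::
    "'a::topological_space set \<Rightarrow> 'b::metric_space set \<Rightarrow> ('b \<Rightarrow> 'a measure) \<Rightarrow> bool" where
  "continuous_in_total_variation S T \<Phi> \<longleftrightarrow>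
     (\<forall>t t0. (\<forall>n. t n \<in> T) \<and> t0 \<in> T \<and> t \<longlonglongrightarrow> t0 \<longrightarrow>
       (\<lambda>n. SUP B\<in>sets (borel_on S). \<bar>measure (\<Phi> (t n)) B - measure (\<Phi> t0) B\<bar>) \<longlonglongrightarrow> 0)"

text \<open>\<open>slice_measure S1 \<mu> B\<close> is the measure \<open>\<Psi>(ds1, B | s3)\<close> if \<open>\<mu> = \<Psi>(\<cdot> | s3)\<close>.\<close>

definition slice_measure ::
    "'a::topological_space set \<Rightarrow> ('a \<times> 'b) measure \<Rightarrow> 'b set \<Rightarrow> 'a measure" where
  "slice_measure S1 \<mu> B =
     measure_of S1 (sets (borel_on S1)) (\<lambda>A. emeasure \<mu> (A \<times> B))"

definition snd_marginal ::
    "'b::topological_space set \<Rightarrow> ('c \<Rightarrow> ('a \<times> 'b) measure) \<Rightarrow> 'c \<Rightarrow> 'b measure" where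
  "snd_marginal S2 \<Psi> s = distr (\<Psi> s) (borel_on S2) snd"

lemma Times_in_borel_on:
  fixes S1 :: "'a::second_countable_topology set" and S2 :: "'b::second_countable_topology set"
  assumes "A \<in> sets (borel_on S1)" "B \<in> sets (borel_on S2)"
  shows "A \<times> B \<in> sets (borel_on (S1 \<times> S2))"
proof -
  obtain A' B' where "A = S1 \<inter> A'" "B = S2 \<inter> B'" "A' \<in> sets borel" "B' \<in> sets borel"
    using assms by (auto simp: sets_restrict_space)
  then show ?thesis
    by (auto simp: sets_restrict_space borel_prod[symmetric] intro!: image_eqI[of _ _ "A' \<times> B'"])
qed

lemma emeasure_slice_measure:
  fixes S1 :: "'a::second_countable_topology set" and S2 :: "'b::second_countable_topology set"
  assumes "sets \<mu> = sets (borel_on (S1 \<times> S2))" "A \<in> sets (borel_on S1)" "B \<in> sets (borel_on S2)"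
  shows "emeasure (slice_measure S1 \<mu> B) A = emeasure \<mu> (A \<times> B)"
proof (rule emeasure_measure_of[OF slice_measure_def])
  show "sets (borel_on S1) \<subseteq> Pow S1"
    by (auto simp: sets_restrict_space)
  show "A \<in> sets (slice_measure S1 \<mu> B)"
    using assms(2) sets.sigma_sets_eq[of "borel_on S1"]
    by (subst slice_measure_def, subst sets_measure_of) (auto simp: sets_restrict_space space_restrict_space)
  show "positive (sets (slice_measure S1 \<mu> B)) (\<lambda>A. emeasure \<mu> (A \<times> B))"
    by (simp add: positive_def)
  have eq: "sets (slice_measure S1 \<mu> B) = sets (borel_on S1)"
    using sets.sigma_sets_eq[of "borel_on S1"]
    by (subst slice_measure_def, subst sets_measure_of) (auto simp: sets_restrict_space space_restrict_space)
  show "countably_additive (sets (slice_measure S1 \<mu> B)) (\<lambda>A. emeasure \<mu> (A \<times> B))"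
  proof (rule countably_additiveI)
    fix X :: "nat \<Rightarrow> 'a set"
    assume X: "range X \<subseteq> sets (slice_measure S1 \<mu> B)" and d: "disjoint_family X"
    have "(\<Sum>i. emeasure \<mu> (X i \<times> B)) = emeasure \<mu> (\<Union>i. X i \<times> B)"
      using X d assms eq
      by (intro suminf_emeasure) (auto simp: disjoint_family_on_def intro!: Times_in_borel_on)
    also have "(\<Union>i. X i \<times> B) = (\<Union>i. X i) \<times> B" by auto
    finally show "(\<Sum>i. emeasure \<mu> (X i \<times> B)) = emeasure \<mu> ((\<Union>i. X i) \<times> B)" .
  qed
qed

lemma emeasure_snd_marginal:
  fixes S1 :: "'a::second_countable_topology set" and S2 :: "'b::second_countable_topology set"
  assumes "sets (\<Psi> s) = sets (borel_on (S1 \<times> S2))" "B \<in> sets (borel_on S2)"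
  shows "emeasure (snd_marginal S2 \<Psi> s) B = emeasure (\<Psi> s) (S1 \<times> B)"
proof -
  have sp: "space (\<Psi> s) = S1 \<times> S2"
    using sets_eq_imp_space_eq[OF assms(1)] by (simp add: space_restrict_space)
  have *: "snd -` B' \<inter> space (\<Psi> s) = S1 \<times> B'" if "B' \<in> sets (borel_on S2)" for B'
    using that sp by (auto simp: sets_restrict_space)
  have "S1 \<in> sets (borel_on S1)" by (auto simp: sets_restrict_space intro!: image_eqI[of _ _ UNIV])
  then have "snd -` B' \<inter> space (\<Psi> s) \<in> sets (\<Psi> s)" if "B' \<in> sets (borel_on S2)" for B'
    unfolding *[OF that] assms(1) using that by (intro Times_in_borel_on)
  then have "snd \<in> measurable (\<Psi> s) (borel_on S2)"
    by (intro measurableI) (auto simp: sp space_restrict_space)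
  then show ?thesis
    using assms(2) by (simp add: snd_marginal_def emeasure_distr *)
qed

definition semi_uniform_Feller ::
    "'a::metric_space set \<Rightarrow> 'b::metric_space set \<Rightarrow> 'c::metric_space set
      \<Rightarrow> ('c \<Rightarrow> ('a \<times> 'b) measure) \<Rightarrow> bool" where
  "semi_uniform_Feller S1 S2 S3 \<Psi> \<longleftrightarrow>
     (\<forall>s s0 f. (\<forall>n. s n \<in> S3) \<and> s0 \<in> S3 \<and> s \<longlonglongrightarrow> s0 \<and>
         continuous_on S1 f \<and> bounded (f ` S1) \<longrightarrow>
       (\<lambda>n. SUP B\<in>sets (borel_on S2).
          \<bar>(LINT x|slice_measure S1 (\<Psi> (s n)) B. f x :: real)
            - (LINT x|slice_measure S1 (\<Psi> s0) B. f x)\<bar>) \<longlonglongrightarrow> 0)"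

text \<open>
  The filter \<^term>\<open>at s within S\<close> omits \<open>s\<close> itself; this is harmless here, as the infimum is \<open>0\<close>
  at \<open>s\<close> (or \<open>\<infinity>\<close> if \<open>F\<close> is empty), and the inferior limit at an isolated point is \<open>\<infinity>\<close>.
  The extended reals allow for infima that are not finite.
\<close>

definition lower_semi_equicontinuous :: "'a::metric_space set \<Rightarrow> ('a \<Rightarrow> real) set \<Rightarrow> bool" where
  "lower_semi_equicontinuous S F \<longleftrightarrow>
     (\<forall>s\<in>S. Liminf (at s within S) (\<lambda>s'. INF f\<in>F. ereal (f s' - f s)) \<ge> 0)"

definition WTV_continuous ::
    "'a::metric_space set \<Rightarrow> 'b::metric_space set \<Rightarrow> 'c::metric_space set
      \<Rightarrow> ('c \<Rightarrow> ('a \<times> 'b) measure) \<Rightarrow> bool" where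
  "WTV_continuous S1 S2 S3 \<Psi> \<longleftrightarrow>
     (\<forall>U. openin (top_of_set S1) U \<longrightarrow>
       lower_semi_equicontinuous S3 {\<lambda>s. measure (\<Psi> s) (U \<times> B) | B. B \<in> sets (borel_on S2)})"

definition closed_set_condition ::
    "'a::metric_space set \<Rightarrow> 'b::metric_space set \<Rightarrow> 'c::metric_space set
      \<Rightarrow> ('c \<Rightarrow> ('a \<times> 'b) measure) \<Rightarrow> bool" where
  "closed_set_condition S1 S2 S3 \<Psi> \<longleftrightarrow>
     (\<forall>s s0. (\<forall>n. s n \<in> S3) \<and> s0 \<in> S3 \<and> s \<longlonglongrightarrow> s0 \<longrightarrow>
       (\<forall>C. closedin (top_of_set S1) C \<longrightarrow>
         (\<lambda>n. SUP B\<in>sets (borel_on S2).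
            measure (\<Psi> (s n)) (C \<times> B) - measure (\<Psi> s0) (C \<times> B)) \<longlonglongrightarrow> 0))"

definition continuity_set_condition ::
    "'a::metric_space set \<Rightarrow> 'b::metric_space set \<Rightarrow> 'c::metric_space set
      \<Rightarrow> ('c \<Rightarrow> ('a \<times> 'b) measure) \<Rightarrow> bool" where
  "continuity_set_condition S1 S2 S3 \<Psi> \<longleftrightarrow>
     (\<forall>s s0. (\<forall>n. s n \<in> S3) \<and> s0 \<in> S3 \<and> s \<longlonglongrightarrow> s0 \<longrightarrow>
       (\<forall>A\<in>sets (borel_on S1).
         measure (\<Psi> s0) ((top_of_set S1 frontier_of A) \<times> S2) = 0 \<longrightarrow>
         (\<lambda>n. SUP B\<in>sets (borel_on S2).
            \<bar>measure (\<Psi> (s n)) (A \<times> B) - measure (\<Psi> s0) (A \<times> B)\<bar>) \<longlonglongrightarrow> 0))"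

definition lower_semicontinuous_on :: "'a::metric_space set \<Rightarrow> ('a \<Rightarrow> real) \<Rightarrow> bool" where
  "lower_semicontinuous_on S f \<longleftrightarrow>
     (\<forall>x\<in>S. ereal (f x) \<le> Liminf (at x within S) (\<lambda>y. ereal (f y)))"

definition lower_semicontinuous_condition ::
    "'a::metric_space set \<Rightarrow> 'b::metric_space set \<Rightarrow> 'c::metric_space set
      \<Rightarrow> ('c \<Rightarrow> ('a \<times> 'b) measure) \<Rightarrow> bool" where
  "lower_semicontinuous_condition S1 S2 S3 \<Psi> \<longleftrightarrow>
     (\<forall>s s0. (\<forall>n. s n \<in> S3) \<and> s0 \<in> S3 \<and> s \<longlonglongrightarrow> s0 \<longrightarrow>
       (\<forall>f. (\<forall>x\<in>S1. 0 \<le> f x) \<and> bounded (f ` S1) \<and> lower_semicontinuous_on S1 f \<longrightarrow>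
         liminf (\<lambda>n. INF B\<in>sets (borel_on S2).
            ereal ((LINT x|slice_measure S1 (\<Psi> (s n)) B. f x)
              - (LINT x|slice_measure S1 (\<Psi> s0) B. f x))) = 0))"

end

theory Submission
  imports Defs
begin

text \<open>
  For a fixed sequence \<open>s\<^sub>3\<^sup>n \<rightarrow> s\<^sub>3\<close> the theorem is the portmanteau theorem for the slices
  \<open>\<Psi>(ds\<^sub>1, B | s\<^sub>3)\<close>, uniformly in \<open>B\<close>. The usual arguments stay uniform because every error term
  is the limit mass of a small set \<open>N\<close>, and \<open>\<Psi>(N \<times> B | s\<^sub>3) \<le> \<Psi>(N \<times> S\<^sub>2 | s\<^sub>3)\<close>. The slices have
  varying total mass, but a one-sided bound on the masses \<open>\<Psi>(S\<^sub>1 \<times> B | \<cdot>)\<close> that is uniform in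
  \<open>B\<close> is two-sided: replace \<open>B\<close> by its complement. This gives convergence of the marginals
  in total variation and allows passing from open to closed sets.
\<close>

section \<open>One-sided uniform convergence\<close>

text \<open>All five conditions, although phrased with suprema, lower limits or lower
  semi-equicontinuity, reduce to inequalities \<open>g n i <= h i + e\<close> for large
  \<open>n\<close>, uniformly in \<open>i\<close>. Those stated as a limit equal to 0 ask for no
  more than this, because the difference vanishes at the empty \<open>B\<close>.

  Such one-sided bounds survive sums and nonnegative multiples but not subtraction, and this is the
  obstacle. Taking the complement of a set, or replacing \<open>f\<close> by \<open>f + K\<close> to
  make it nonnegative, brings in the total mass, which varies with \<open>n\<close> and
  \<open>B\<close>. So each such step first extracts a mass bound from the condition itself, using
  the whole space or the constant function 1, and then adds it with the right sign.

  Approximations are asymmetric. Nothing is known about small sets under the measures of the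
  sequence, so there the comparison has to be exact, by monotonicity; only the limit measures may
  contribute an error.\<close>

definition unif_le :: "'i set \<Rightarrow> (nat \<Rightarrow> 'i \<Rightarrow> real) \<Rightarrow> ('i \<Rightarrow> real) \<Rightarrow> bool" where
  "unif_le I g h \<longleftrightarrow> (\<forall>e>0. \<forall>\<^sub>F n in sequentially. \<forall>i\<in>I. g n i \<le> h i + e)"

lemma unif_leI:
  assumes "\<And>e. e > 0 \<Longrightarrow> \<forall>\<^sub>F n in sequentially. \<forall>i\<in>I. g n i \<le> h i + e"
  shows "unif_le I g h"
  using assms by (simp add: unif_le_def)

lemma unif_leD:
  assumes "unif_le I g h" "e > 0"
  shows "\<forall>\<^sub>F n in sequentially. \<forall>i\<in>I. g n i \<le> h i + e"
  using assms by (simp add: unif_le_def)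

text \<open>The form of every sandwich below: enlarging a set or a function costs nothing along the
  sequence, for any \<open>n\<close>, while the price \<open>e\<close> is paid at the limit
  only.\<close>

lemma unif_le_approx:
  assumes "\<And>e. e > 0 \<Longrightarrow> \<exists>g' h'. unif_le I g' h' \<and>
    (\<forall>n. \<forall>i\<in>I. g n i \<le> g' n i) \<and> (\<forall>i\<in>I. h' i \<le> h i + e)"
  shows "unif_le I g h"
proof (rule unif_leI)
  fix e :: real assume "e > 0"
  then obtain g' h' where *: "unif_le I g' h'"
    "\<And>n i. i \<in> I \<Longrightarrow> g n i \<le> g' n i" "\<And>i. i \<in> I \<Longrightarrow> h' i \<le> h i + e/2"
    using assms[of "e/2"] by auto
  show "\<forall>\<^sub>F n in sequentially. \<forall>i\<in>I. g n i \<le> h i + e"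
    using unif_leD[OF *(1), of "e/2"] \<open>e > 0\<close>
    by (auto elim!: eventually_mono) (smt (verit) *(2,3) field_sum_of_halves)
qed

lemma unif_le_cong:
  assumes "\<And>n i. i \<in> I \<Longrightarrow> g n i = g' n i" "\<And>i. i \<in> I \<Longrightarrow> h i = h' i"
  shows "unif_le I g h \<longleftrightarrow> unif_le I g' h'"
  using assms by (simp add: unif_le_def)

lemma unif_le_const: "unif_le I (\<lambda>n. h) h"
  by (simp add: unif_le_def)

lemma unif_le_add:
  assumes "unif_le I g h" "unif_le I g' h'"
  shows "unif_le I (\<lambda>n i. g n i + g' n i) (\<lambda>i. h i + h' i)"
proof (rule unif_leI)
  fix e :: real assume "e > 0"
  then have "\<forall>\<^sub>F n in sequentially. \<forall>i\<in>I. g n i \<le> h i + e/2"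
    "\<forall>\<^sub>F n in sequentially. \<forall>i\<in>I. g' n i \<le> h' i + e/2"
    using assms by (auto intro!: unif_leD)
  then show "\<forall>\<^sub>F n in sequentially. \<forall>i\<in>I. g n i + g' n i \<le> h i + h' i + e"
    by eventually_elim (smt (verit) field_sum_of_halves)
qed

lemma unif_le_cmult:
  fixes c :: real
  assumes "unif_le I g h" "c \<ge> 0"
  shows "unif_le I (\<lambda>n i. c * g n i) (\<lambda>i. c * h i)"
proof (cases "c = 0")
  case True
  then show ?thesis using unif_le_const[of I "\<lambda>_. 0"] by simp
next
  case False
  with assms(2) have c: "c > 0" by simp
  show ?thesis
  proof (rule unif_leI)
    fix e :: real assume "e > 0"
    then have "\<forall>\<^sub>F n in sequentially. \<forall>i\<in>I. g n i \<le> h i + e/c"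
      using assms c by (auto intro!: unif_leD)
    then show "\<forall>\<^sub>F n in sequentially. \<forall>i\<in>I. c * g n i \<le> c * h i + e"
      by eventually_elim (use c in \<open>auto simp: field_simps\<close>)
  qed
qed

lemma unif_le_sum:
  assumes "finite K" "\<And>k. k \<in> K \<Longrightarrow> unif_le I (g k) (h k)"
  shows "unif_le I (\<lambda>n i. \<Sum>k\<in>K. g k n i) (\<lambda>i. \<Sum>k\<in>K. h k i)"
  using assms
proof (induction K rule: finite_induct)
  case empty
  then show ?case using unif_le_const[of I "\<lambda>_. 0"] by simp
next
  case (insert k K)
  then show ?case by (simp add: unif_le_add)
qed

section \<open>Uniform limits, suprema and lower limits as one-sided uniform bounds\<close>

lemma uniform_limit_iff_unif_le:
  fixes g :: "nat \<Rightarrow> 'i \<Rightarrow> real"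
  shows "uniform_limit I g h sequentially \<longleftrightarrow>
    unif_le I g h \<and> unif_le I (\<lambda>n i. - g n i) (\<lambda>i. - h i)"
proof
  assume L: "uniform_limit I g h sequentially"
  have "\<forall>\<^sub>F n in sequentially. \<forall>i\<in>I. g n i \<le> h i + e \<and> - g n i \<le> - h i + e" if "e > 0" for e
  proof -
    have "\<forall>\<^sub>F n in sequentially. \<forall>i\<in>I. \<bar>g n i - h i\<bar> < e"
      using L that by (simp add: uniform_limit_iff dist_real_def)
    then show ?thesis by eventually_elim force
  qed
  then show "unif_le I g h \<and> unif_le I (\<lambda>n i. - g n i) (\<lambda>i. - h i)"
    by (auto simp: unif_le_def ball_conj_distrib eventually_conj_iff)
next
  assume R: "unif_le I g h \<and> unif_le I (\<lambda>n i. - g n i) (\<lambda>i. - h i)"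
  show "uniform_limit I g h sequentially"
    unfolding uniform_limit_iff
  proof (intro allI impI)
    fix e :: real assume e: "e > 0"
    have "\<forall>\<^sub>F n in sequentially. \<forall>i\<in>I. g n i \<le> h i + e/2"
      "\<forall>\<^sub>F n in sequentially. \<forall>i\<in>I. - g n i \<le> - h i + e/2"
      using R e by (auto dest!: unif_leD[where e="e/2"])
    then show "\<forall>\<^sub>F n in sequentially. \<forall>i\<in>I. dist (g n i) (h i) < e"
      by eventually_elim (use e in \<open>force simp: dist_real_def abs_less_iff\<close>)
  qed
qed

text \<open>The index \<open>j\<close> keeps the supremum nonnegative, so convergence to 0 carries
  no information beyond the upper bound. For the kernels \<open>j\<close> is the empty set.\<close>

lemma SUP_tendsto_0_iff:
  fixes g :: "nat \<Rightarrow> 'i \<Rightarrow> real"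
  assumes "\<And>n. bdd_above (g n ` I)" "j \<in> I" "\<And>n. 0 \<le> g n j"
  shows "(\<lambda>n. SUP i\<in>I. g n i) \<longlonglongrightarrow> 0 \<longleftrightarrow> unif_le I g (\<lambda>_. 0)"
proof -
  have nn: "0 \<le> (SUP i\<in>I. g n i)" for n
    using assms by (intro cSUP_upper2[of _ _ j])
  have le: "(SUP i\<in>I. g n i) \<le> e \<longleftrightarrow> (\<forall>i\<in>I. g n i \<le> e)" for n e
    using assms by (intro cSUP_le_iff) auto
  show ?thesis
  proof
    assume L: "(\<lambda>n. SUP i\<in>I. g n i) \<longlonglongrightarrow> 0"
    show "unif_le I g (\<lambda>_. 0)"
    proof (rule unif_leI)
      fix e :: real assume "e > 0"
      with L have "\<forall>\<^sub>F n in sequentially. (SUP i\<in>I. g n i) < e"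
        by (rule order_tendstoD(2))
      then show "\<forall>\<^sub>F n in sequentially. \<forall>i\<in>I. g n i \<le> 0 + e"
        by eventually_elim (simp add: le[symmetric])
    qed
  next
    assume R: "unif_le I g (\<lambda>_. 0)"
    show "(\<lambda>n. SUP i\<in>I. g n i) \<longlonglongrightarrow> 0"
    proof (rule tendstoI)
      fix e :: real assume "e > 0"
      with R have "\<forall>\<^sub>F n in sequentially. \<forall>i\<in>I. g n i \<le> 0 + e/2"
        by (intro unif_leD) auto
      then show "\<forall>\<^sub>F n in sequentially. dist (SUP i\<in>I. g n i) 0 < e"
      proof eventually_elim
        case (elim n)
        then have "(SUP i\<in>I. g n i) \<le> e/2" by (simp only: le add_0)
        with nn[of n] \<open>e > 0\<close> show ?case by (simp add: dist_real_def)
      qed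
    qed
  qed
qed

lemma unif_le_diff_0_iff: "unif_le I (\<lambda>n i. g n i - h i) (\<lambda>_. 0) \<longleftrightarrow> unif_le I g h"
  by (simp add: unif_le_def algebra_simps)

lemma unif_le_abs_diff_0_iff:
  fixes g :: "nat \<Rightarrow> 'i \<Rightarrow> real"
  shows "unif_le I (\<lambda>n i. \<bar>g n i - h i\<bar>) (\<lambda>_. 0) \<longleftrightarrow> uniform_limit I g h sequentially"
proof -
  have "unif_le I (\<lambda>n i. \<bar>g n i - h i\<bar>) (\<lambda>_. 0) \<longleftrightarrow>
      unif_le I g h \<and> unif_le I (\<lambda>n i. - g n i) (\<lambda>i. - h i)"
    unfolding unif_le_def
    by (auto simp: abs_le_iff algebra_simps ball_conj_distrib eventually_conj_iff)
  then show ?thesis by (simp add: uniform_limit_iff_unif_le)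
qed

text \<open>The filter is arbitrary because the lemma serves both \<open>at t within S3\<close> in
  WTV-continuity and \<open>sequentially\<close> in the condition on lower semicontinuous
  functions.\<close>

lemma Liminf_INF_nonneg_iff:
  fixes g :: "'s \<Rightarrow> 'i \<Rightarrow> real"
  shows "0 \<le> Liminf F (\<lambda>x. INF i\<in>I. ereal (g x i)) \<longleftrightarrow>
    (\<forall>e>0. \<forall>\<^sub>F x in F. \<forall>i\<in>I. - e \<le> g x i)"
proof
  assume L: "0 \<le> Liminf F (\<lambda>x. INF i\<in>I. ereal (g x i))"
  show "\<forall>e>0. \<forall>\<^sub>F x in F. \<forall>i\<in>I. - e \<le> g x i"
  proof (intro allI impI)
    fix e :: real assume "e > 0"
    then have "ereal (- e) < 0" by simp
    with L have "\<forall>\<^sub>F x in F. ereal (- e) < (INF i\<in>I. ereal (g x i))"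
      unfolding le_Liminf_iff by blast
    then show "\<forall>\<^sub>F x in F. \<forall>i\<in>I. - e \<le> g x i"
    proof eventually_elim
      case (elim x)
      then have "ereal (- e) \<le> (INF i\<in>I. ereal (g x i))" by simp
      then show ?case by (simp add: le_INF_iff)
    qed
  qed
next
  assume R: "\<forall>e>0. \<forall>\<^sub>F x in F. \<forall>i\<in>I. - e \<le> g x i"
  show "0 \<le> Liminf F (\<lambda>x. INF i\<in>I. ereal (g x i))"
    unfolding le_Liminf_iff
  proof (intro allI impI)
    fix y :: ereal assume "y < 0"
    \<comment> \<open>Bounds on all members bound an infimum only non-strictly, so a real number is
      put strictly between \<open>y\<close> and 0 to keep \<open>y <\<close> strict.\<close>
    then obtain e where e: "e < 0" "y < ereal e"
      using ereal_dense2[of y 0] by auto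
    have "\<forall>\<^sub>F x in F. \<forall>i\<in>I. - (- e) \<le> g x i" using R e(1) by (metis neg_0_less_iff_less)
    then show "\<forall>\<^sub>F x in F. y < (INF i\<in>I. ereal (g x i))"
    proof eventually_elim
      case (elim x)
      then have "ereal e \<le> (INF i\<in>I. ereal (g x i))" by (simp add: le_INF_iff)
      with e(2) show ?case by simp
    qed
  qed
qed

text \<open>The filter omits \<open>a\<close>, whereas the sequences may visit it;
  \<open>P a\<close> bridges the gap.\<close>

lemma eventually_at_within_iff_sequentially:
  fixes a :: "'a::metric_space"
  assumes "P a"
  shows "eventually P (at a within S) \<longleftrightarrow>
    (\<forall>s. (\<forall>n. s n \<in> S) \<and> s \<longlonglongrightarrow> a \<longrightarrow> (\<forall>\<^sub>F n in sequentially. P (s n)))"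
proof
  assume E: "eventually P (at a within S)"
  then obtain d where d: "d > 0" "\<And>x. x \<in> S \<Longrightarrow> x \<noteq> a \<Longrightarrow> dist x a < d \<Longrightarrow> P x"
    by (auto simp: eventually_at)
  show "\<forall>s. (\<forall>n. s n \<in> S) \<and> s \<longlonglongrightarrow> a \<longrightarrow> (\<forall>\<^sub>F n in sequentially. P (s n))"
  proof (intro allI impI)
    fix s assume s: "(\<forall>n. s n \<in> S) \<and> s \<longlonglongrightarrow> a"
    then have "\<forall>\<^sub>F n in sequentially. dist (s n) a < d" using d(1) by (auto dest: tendstoD)
    then show "\<forall>\<^sub>F n in sequentially. P (s n)"
      by eventually_elim (use d s assms in metis)
  qed
next
  assume "\<forall>s. (\<forall>n. s n \<in> S) \<and> s \<longlonglongrightarrow> a \<longrightarrow> (\<forall>\<^sub>F n in sequentially. P (s n))"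
  then show "eventually P (at a within S)"
    by (intro sequentially_imp_eventually_within) auto
qed

section \<open>Lower semicontinuous functions and metric neighbourhoods\<close>

lemma sets_borel_on_openin: "openin (top_of_set S) U \<Longrightarrow> U \<in> sets (borel_on S)"
  unfolding sets_borel_on by auto

lemma sets_borel_on_closedin: "closedin (top_of_set S) C \<Longrightarrow> C \<in> sets (borel_on S)"
  by (auto simp: closedin_closed sets_restrict_space)

lemma lower_semicontinuous_on_openin:
  assumes "lower_semicontinuous_on S f"
  shows "openin (top_of_set S) {x\<in>S. t < f x}"
proof (subst openin_subopen, intro ballI)
  fix x assume x: "x \<in> {x\<in>S. t < f x}"
  then have "ereal t < ereal (f x)" "ereal (f x) \<le> Liminf (at x within S) (\<lambda>y. ereal (f y))"
    using assms by (auto simp: lower_semicontinuous_on_def)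
  then have "\<forall>\<^sub>F y in at x within S. ereal t < ereal (f y)"
    unfolding le_Liminf_iff by blast
  then obtain V where V: "open V" "x \<in> V" "\<And>y. y \<in> V \<Longrightarrow> y \<noteq> x \<Longrightarrow> y \<in> S \<Longrightarrow> t < f y"
    by (auto simp: eventually_at_topological)
  show "\<exists>T. openin (top_of_set S) T \<and> x \<in> T \<and> T \<subseteq> {x\<in>S. t < f x}"
    by (rule exI[of _ "S \<inter> V"]) (use V x in \<open>auto simp: openin_open_Int\<close>)
qed

lemma continuous_on_imp_lower_semicontinuous_on:
  assumes "continuous_on S f"
  shows "lower_semicontinuous_on S f"
  unfolding lower_semicontinuous_on_def le_Liminf_iff
proof (intro ballI allI impI)
  fix x y assume "x \<in> S" "y < ereal (f x)"
  moreover from this assms have "((\<lambda>z. ereal (f z)) \<longlongrightarrow> ereal (f x)) (at x within S)"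
    by (auto simp: continuous_on)
  ultimately show "\<forall>\<^sub>F z in at x within S. y < ereal (f z)"
    by (blast dest: order_tendstoD(1))
qed

lemma lower_semicontinuous_on_measurable:
  assumes "lower_semicontinuous_on S f"
  shows "f \<in> borel_measurable (borel_on S)"
  unfolding borel_measurable_iff_greater
  using lower_semicontinuous_on_openin[OF assms]
  by (auto simp: space_restrict_space intro!: sets_borel_on_openin)

text \<open>The ambient closure of a relatively closed \<open>C\<close> may be larger than
  \<open>C\<close>, but adds no points of \<open>S\<close>. The empty set is excluded because
  \<open>infdist x {}\<close> is 0 by convention.\<close>

lemma infdist_eq_0_iff_closedin:
  assumes "closedin (top_of_set S) C" "C \<noteq> {}" "x \<in> S"
  shows "infdist x C = 0 \<longleftrightarrow> x \<in> C"
proof -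
  obtain T where T: "closed T" "C = S \<inter> T" using assms(1) by (auto simp: closedin_closed)
  then have "closure C \<subseteq> T" by (simp add: closure_minimal)
  then have "x \<in> closure C \<longleftrightarrow> x \<in> C"
    using T assms(3) closure_subset[of C] by auto
  then show ?thesis using in_closure_iff_infdist_zero[OF assms(2)] by simp
qed

lemma closedin_infdist_le: "closedin (top_of_set S) {x\<in>S. infdist x C \<le> r}"
proof -
  have "{x\<in>S. infdist x C \<le> r} = S \<inter> {x. infdist x C \<le> r}" by auto
  moreover have "closed {x. infdist x C \<le> r}"
    by (intro closed_Collect_le continuous_intros)
  ultimately show ?thesis by (auto simp: closedin_closed)
qed

text \<open>Spheres of different radii are disjoint, so this inclusion makes it possible to choose a
  radius whose neighbourhood has a null frontier.\<close>

lemma frontier_of_infdist_le: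
  "top_of_set S frontier_of {x\<in>S. infdist x C \<le> r} \<subseteq> {x\<in>S. infdist x C = r}"
proof -
  have "{x\<in>S. infdist x C < r} = S \<inter> {x. infdist x C < r}" by auto
  moreover have "open {x. infdist x C < r}"
    by (intro open_Collect_less continuous_intros)
  ultimately have "openin (top_of_set S) {x\<in>S. infdist x C < r}"
    by (auto simp: openin_open)
  then have "{x\<in>S. infdist x C < r} \<subseteq> top_of_set S interior_of {x\<in>S. infdist x C \<le> r}"
    by (intro interior_of_maximal) auto
  then show ?thesis
    using closure_of_closedin[OF closedin_infdist_le[of S C r]]
    by (auto simp: frontier_of_def)
qed

text \<open>Continuity from above along the radii \<open>1 / Suc k\<close>: a point of
  \<open>S\<close> at distance 0 from the closed set \<open>C\<close> belongs to it.\<close>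

lemma measure_infdist_neighbourhood:
  assumes "finite_measure M" "sets M = sets (borel_on S)"
    "closedin (top_of_set S) C" "C \<noteq> {}" "e > 0"
  shows "\<exists>r>0. measure M ({x\<in>S. infdist x C \<le> r} - C) \<le> e"
proof -
  interpret finite_measure M by fact
  \<comment> \<open>With \<open>C\<close> removed, the neighbourhoods decrease to the empty set, so
    their measures tend to 0.\<close>
  define A where "A k = {x\<in>S. infdist x C \<le> 1 / real (Suc k)} - C" for k
  have sets: "range A \<subseteq> sets M"
    unfolding A_def assms(2)
    using sets_borel_on_closedin[OF closedin_infdist_le] sets_borel_on_closedin[OF assms(3)]
    by auto
  have "decseq A"
  proof (intro decseq_SucI subsetI)
    fix k x assume "x \<in> A (Suc k)"
    moreover have "1 / real (Suc (Suc k)) \<le> 1 / real (Suc k)" by (simp add: field_simps)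
    ultimately show "x \<in> A k" unfolding A_def by auto
  qed
  with sets have "(\<lambda>k. measure M (A k)) \<longlonglongrightarrow> measure M (\<Inter>k. A k)"
    by (rule finite_Lim_measure_decseq)
  also have "(\<Inter>k. A k) = {}"
  proof (rule ccontr)
    assume "(\<Inter>k. A k) \<noteq> {}"
    then obtain x where x: "\<And>k. x \<in> A k" by blast
    have "infdist x C \<le> 0"
    proof (rule LIMSEQ_le_const)
      show "(\<lambda>k. 1 / real (Suc k)) \<longlonglongrightarrow> 0" by (rule LIMSEQ_Suc, rule lim_1_over_n)
      show "\<exists>N. \<forall>n\<ge>N. infdist x C \<le> 1 / real (Suc n)" using x by (auto simp: A_def)
    qed
    then have "infdist x C = 0" using infdist_nonneg[of x C] by simp
    then show False
      using x[of 0] infdist_eq_0_iff_closedin[OF assms(3,4), of x] by (auto simp: A_def)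
  qed
  finally have "\<forall>\<^sub>F k in sequentially. measure M (A k) < e"
    using \<open>e > 0\<close> by (auto dest: order_tendstoD)
  then obtain k where "measure M (A k) < e" by (auto simp: eventually_sequentially)
  then show ?thesis by (intro exI[of _ "1 / real (Suc k)"]) (auto simp: A_def)
qed

text \<open>The image measure under \<open>f\<close> is finite and hence has at most countably many
  atoms, while the interval is uncountable.\<close>

lemma finite_measure_null_level_set:
  fixes f :: "'a \<Rightarrow> real"
  assumes "finite_measure M" "f \<in> borel_measurable M" "a < b"
  shows "\<exists>r\<in>{a<..<b}. measure M {x\<in>space M. f x = r} = 0"
proof -
  interpret finite_measure M by fact
  interpret D: finite_measure "distr M borel f"
    using assms(2) by (rule finite_measure_distr)
  have "countable {r. measure (distr M borel f) {r} \<noteq> 0}"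
    by (rule D.countable_support)
  moreover have "uncountable {a<..<b}" using assms(3) by (rule uncountable_open_interval[THEN iffD2])
  ultimately obtain r where "r \<in> {a<..<b}" "measure (distr M borel f) {r} = 0"
    by (metis (mono_tags, lifting) countable_subset mem_Collect_eq subsetI)
  moreover have "f -` {r} \<inter> space M = {x\<in>space M. f x = r}" by auto
  ultimately show ?thesis using assms(2) by (auto simp: measure_distr)
qed


text \<open>A discrete layer-cake formula: the sum is \<open>d\<close> times the number of positive
  multiples of \<open>d\<close> strictly below \<open>y\<close>. Strictness matters, since
  \<open>{x. t < f x}\<close> is the open level set of a lower semicontinuous
  \<open>f\<close>.\<close>

lemma layer_sum_bounds:
  fixes y d :: real
  assumes "0 < d" "0 \<le> y" "y \<le> real m * d"
  shows "(\<Sum>k=1..m. d * of_bool (real k * d < y)) \<le> y"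
    and "y \<le> (\<Sum>k=1..m. d * of_bool (real k * d < y)) + d"
proof -
  \<comment> \<open>The positive integers strictly below \<open>y/d\<close> number its ceiling minus
    one; the bound \<open>y <= m * d\<close> ensures that none of them exceeds
    \<open>m\<close>.\<close>
  have eq: "{k\<in>{1..m}. real k * d < y} = {1..nat (\<lceil>y/d\<rceil> - 1)}" (is "?L = ?R")
  proof (intro set_eqI iffI)
    fix k assume "k \<in> ?L"
    then have "1 \<le> k" "real_of_int (int k) < y/d" by (simp_all only: mem_Collect_eq atLeastAtMost_iff of_int_of_nat_eq pos_less_divide_eq[OF assms(1)])
    moreover from this(2) have "int k < \<lceil>y/d\<rceil>" by (simp only: less_ceiling_iff)
    ultimately show "k \<in> ?R" by simp
  next
    fix k assume "k \<in> ?R"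
    then have k: "1 \<le> k" "int k < \<lceil>y/d\<rceil>" by auto
    then have kd: "real k < y/d" by (simp only: less_ceiling_iff of_int_of_nat_eq)
    moreover have "y/d \<le> real m" using assms by (simp add: field_simps)
    ultimately have "k \<le> m" by linarith
    with kd show "k \<in> ?L" using k(1) assms(1) by (simp add: field_simps)
  qed
  have "(\<Sum>k=1..m. d * of_bool (real k * d < y)) = d * real (card {k\<in>{1..m}. real k * d < y})"
    by (simp add: sum_distrib_left[symmetric] sum_of_bool_eq Int_def)
  also have "\<dots> = d * real (nat (\<lceil>y/d\<rceil> - 1))" by (simp only: eq card_atLeastAtMost) simp
  finally have sum: "(\<Sum>k=1..m. d * of_bool (real k * d < y)) = d * real (nat (\<lceil>y/d\<rceil> - 1))" .
  have "real (nat (\<lceil>y/d\<rceil> - 1)) \<le> y/d"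
  proof (cases "1 \<le> \<lceil>y/d\<rceil>")
    case True
    then have "real (nat (\<lceil>y/d\<rceil> - 1)) = real_of_int \<lceil>y/d\<rceil> - 1" by simp
    then show ?thesis by linarith
  next
    \<comment> \<open>Only \<open>y = 0\<close> arrives here: the ceiling minus one is -1, and
      \<open>nat\<close> cuts it off at 0.\<close>
    case False
    then have "nat (\<lceil>y/d\<rceil> - 1) = 0" by simp
    moreover have "0 \<le> y/d" using assms(1,2) by simp
    ultimately show ?thesis by simp
  qed
  then show "(\<Sum>k=1..m. d * of_bool (real k * d < y)) \<le> y"
    unfolding sum using assms(1) by (simp add: field_simps)
  have "y/d \<le> real (nat (\<lceil>y/d\<rceil> - 1)) + 1" by linarith
  then show "y \<le> (\<Sum>k=1..m. d * of_bool (real k * d < y)) + d"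
    unfolding sum using assms(1) by (simp add: field_simps)
qed

section \<open>A uniform portmanteau theorem\<close>

text \<open>
  The example in mind is \<open>\<kappa> B = \<Psi>(ds\<^sub>1, B | s\<^sub>3)\<close> with \<open>c\<close> the complement in \<open>S\<^sub>2\<close> and
  \<open>j = S\<^sub>2\<close>.
\<close>

locale slice_family =
  fixes S :: "'a::metric_space set" and I :: "'i set" and c :: "'i \<Rightarrow> 'i" and j :: 'i
    and \<kappa> :: "'i \<Rightarrow> 'a measure"
  assumes finite_\<kappa>: "i \<in> I \<Longrightarrow> finite_measure (\<kappa> i)"
    and sets_\<kappa>: "i \<in> I \<Longrightarrow> sets (\<kappa> i) = sets (borel_on S)"
    and c_closed: "i \<in> I \<Longrightarrow> c i \<in> I"
    and mass_c: "i \<in> I \<Longrightarrow> measure (\<kappa> i) S + measure (\<kappa> (c i)) S = 1"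
    and j_in: "j \<in> I"
    and dominated: "i \<in> I \<Longrightarrow> A \<in> sets (borel_on S) \<Longrightarrow> measure (\<kappa> i) A \<le> measure (\<kappa> j) A"
begin

section \<open>Elementary estimates within one family of slices\<close>

lemma space_\<kappa>: "i \<in> I \<Longrightarrow> space (\<kappa> i) = S"
  using sets_eq_imp_space_eq[OF sets_\<kappa>] by (simp add: space_restrict_space)

lemma S_in_sets: "S \<in> sets (borel_on S)"
  by (rule sets_borel_on_openin) simp

lemma mass_le_1: "i \<in> I \<Longrightarrow> measure (\<kappa> i) S \<le> 1"
  using mass_c[of i] measure_nonneg[of "\<kappa> (c i)" S] by linarith

lemma measure_\<kappa>_mono:
  assumes "i \<in> I" "A \<subseteq> B" "B \<in> sets (borel_on S)"
  shows "measure (\<kappa> i) A \<le> measure (\<kappa> i) B"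
  using assms finite_measure.finite_measure_mono[OF finite_\<kappa>] sets_\<kappa> by blast

lemma measure_\<kappa>_le_add:
  assumes "i \<in> I" "A \<subseteq> B \<union> N" "B \<in> sets (borel_on S)" "N \<in> sets (borel_on S)"
    "measure (\<kappa> j) N \<le> e"
  shows "measure (\<kappa> i) A \<le> measure (\<kappa> i) B + e"
proof -
  have "measure (\<kappa> i) A \<le> measure (\<kappa> i) (B \<union> N)"
    using assms by (intro measure_\<kappa>_mono) auto
  also have "\<dots> \<le> measure (\<kappa> i) B + measure (\<kappa> i) N"
    using assms sets_\<kappa>[OF assms(1)] by (intro measure_Un_le) auto
  also have "measure (\<kappa> i) N \<le> e"
    using dominated[OF assms(1,4)] assms(5) by linarith
  finally show ?thesis by simp
qed

lemma integrable_\<kappa>: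
  fixes f :: "'a \<Rightarrow> real"
  assumes "i \<in> I" "f \<in> borel_measurable (borel_on S)" "\<And>x. x \<in> S \<Longrightarrow> \<bar>f x\<bar> \<le> K"
  shows "integrable (\<kappa> i) f"
proof -
  interpret finite_measure "\<kappa> i" using assms(1) by (rule finite_\<kappa>)
  have "f \<in> borel_measurable (\<kappa> i)"
    using assms(2) by (simp cong: measurable_cong_sets add: sets_\<kappa>[OF assms(1)])
  then show ?thesis
    using assms(3) space_\<kappa>[OF assms(1)] by (intro integrable_const_bound[of _ K]) auto
qed

lemma integral_\<kappa>_indicator:
  assumes "i \<in> I" "A \<in> sets (borel_on S)"
  shows "integrable (\<kappa> i) (indicator A :: 'a \<Rightarrow> real)"
    and "(LINT x|\<kappa> i. indicator A x) = measure (\<kappa> i) A"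
proof -
  interpret finite_measure "\<kappa> i" using assms(1) by (rule finite_\<kappa>)
  have A: "A \<in> sets (\<kappa> i)" using assms sets_\<kappa> by simp
  then show "integrable (\<kappa> i) (indicator A :: 'a \<Rightarrow> real)"
    by (intro integrable_real_indicator) (auto simp: less_top[symmetric])
  show "(LINT x|\<kappa> i. indicator A x) = measure (\<kappa> i) A"
    using A sets.sets_into_space[OF A] by (simp add: Int_absorb2)
qed

text \<open>A pointwise error \<open>e\<close> stays \<open>e\<close> after integration, for every
  index, because no slice has mass above 1.\<close>

lemma integral_\<kappa>_le_add:
  fixes f g :: "'a \<Rightarrow> real"
  assumes i: "i \<in> I" and "integrable (\<kappa> i) f" "integrable (\<kappa> i) g"
    and "\<And>x. x \<in> S \<Longrightarrow> f x \<le> g x + e" "0 \<le> e"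
  shows "(LINT x|\<kappa> i. f x) \<le> (LINT x|\<kappa> i. g x) + e"
proof -
  interpret finite_measure "\<kappa> i" using i by (rule finite_\<kappa>)
  have "(LINT x|\<kappa> i. f x) \<le> (LINT x|\<kappa> i. g x + e)"
    using assms space_\<kappa>[OF i] by (intro integral_mono) auto
  also have "\<dots> = (LINT x|\<kappa> i. g x) + e * measure (\<kappa> i) S"
    using assms(3) space_\<kappa>[OF i] by (simp add: integral_add)
  also have "e * measure (\<kappa> i) S \<le> e" using mass_le_1[OF i] \<open>0 \<le> e\<close> by (simp add: mult_left_le)
  finally show ?thesis by simp
qed

lemma abs_integral_\<kappa>_le:
  fixes f :: "'a \<Rightarrow> real"
  assumes "i \<in> I" "f \<in> borel_measurable (borel_on S)" "\<And>x. x \<in> S \<Longrightarrow> \<bar>f x\<bar> \<le> K" "0 \<le> K"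
  shows "\<bar>LINT x|\<kappa> i. f x\<bar> \<le> K"
proof -
  note f = integrable_\<kappa>[OF assms(1-3)]
  have b: "f x \<le> 0 + K \<and> - f x \<le> 0 + K" if "x \<in> S" for x using assms(3)[OF that] by linarith
  have "(LINT x|\<kappa> i. f x) \<le> (LINT x|\<kappa> i. 0) + K"
    using assms(1) f b assms(4) by (intro integral_\<kappa>_le_add) auto
  moreover have "(LINT x|\<kappa> i. - f x) \<le> (LINT x|\<kappa> i. 0) + K"
    using assms(1) f b assms(4) by (intro integral_\<kappa>_le_add) auto
  ultimately show ?thesis by simp
qed

lemma measure_\<kappa>_bounds:
  assumes "i \<in> I" "A \<in> sets (borel_on S)"
  shows "0 \<le> measure (\<kappa> i) A" "measure (\<kappa> i) A \<le> 1"
proof -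
  have "A \<subseteq> S" using sets.sets_into_space[OF assms(2)] by (simp add: space_restrict_space)
  then have "measure (\<kappa> i) A \<le> measure (\<kappa> i) S"
    by (rule measure_\<kappa>_mono[OF assms(1) _ S_in_sets])
  then show "measure (\<kappa> i) A \<le> 1" using mass_le_1[OF assms(1)] by linarith
qed simp

end

locale uniform_portmanteau = lim: slice_family S I c j \<mu>0
  for S :: "'a::metric_space set" and I :: "'i set" and c j and \<mu>0 :: "'i \<Rightarrow> 'a measure" +
  fixes \<mu> :: "nat \<Rightarrow> 'i \<Rightarrow> 'a measure"
  assumes slice_family_seq: "slice_family S I c j (\<mu> n)"
begin

sublocale seq: slice_family S I c j "\<mu> n" for n
  by (rule slice_family_seq)

section \<open>The conditions for a fixed sequence of families\<close>

definition weak_cond :: bool where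
  "weak_cond \<longleftrightarrow> (\<forall>f. continuous_on S f \<and> bounded (f ` S) \<longrightarrow>
     uniform_limit I (\<lambda>n i. LINT x|\<mu> n i. f x :: real) (\<lambda>i. LINT x|\<mu>0 i. f x) sequentially)"

definition open_cond :: bool where
  "open_cond \<longleftrightarrow> (\<forall>U. openin (top_of_set S) U \<longrightarrow>
     unif_le I (\<lambda>n i. - measure (\<mu> n i) U) (\<lambda>i. - measure (\<mu>0 i) U))"

definition closed_cond :: bool where
  "closed_cond \<longleftrightarrow> (\<forall>C. closedin (top_of_set S) C \<longrightarrow>
     unif_le I (\<lambda>n i. measure (\<mu> n i) C) (\<lambda>i. measure (\<mu>0 i) C))"

definition continuity_cond :: bool where
  "continuity_cond \<longleftrightarrow> (\<forall>A\<in>sets (borel_on S). measure (\<mu>0 j) (top_of_set S frontier_of A) = 0 \<longrightarrow>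
     uniform_limit I (\<lambda>n i. measure (\<mu> n i) A) (\<lambda>i. measure (\<mu>0 i) A) sequentially)"

definition lsc_cond :: bool where
  "lsc_cond \<longleftrightarrow> (\<forall>f. (\<forall>x\<in>S. 0 \<le> f x) \<and> bounded (f ` S) \<and> lower_semicontinuous_on S f \<longrightarrow>
     unif_le I (\<lambda>n i. - (LINT x|\<mu> n i. f x)) (\<lambda>i. - (LINT x|\<mu>0 i. f x)))"

text \<open>For a kernel, the slice at \<open>B\<close> has as its mass the value of the second
  marginal at \<open>B\<close>; uniform convergence in \<open>B\<close> is then convergence of the
  marginals in total variation.\<close>

definition mass_cond :: bool where
  "mass_cond \<longleftrightarrow>
     uniform_limit I (\<lambda>n i. measure (\<mu> n i) S) (\<lambda>i. measure (\<mu>0 i) S) sequentially"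

section \<open>Total masses and complements\<close>

lemma mass_cond_iff_upper:
  "mass_cond \<longleftrightarrow> unif_le I (\<lambda>n i. measure (\<mu> n i) S) (\<lambda>i. measure (\<mu>0 i) S)"
proof
  assume *: "unif_le I (\<lambda>n i. measure (\<mu> n i) S) (\<lambda>i. measure (\<mu>0 i) S)"
  moreover have "unif_le I (\<lambda>n i. - measure (\<mu> n i) S) (\<lambda>i. - measure (\<mu>0 i) S)"
  proof (rule unif_leI)
    fix e :: real assume "e > 0"
    with * have "\<forall>\<^sub>F n in sequentially. \<forall>i\<in>I. measure (\<mu> n i) S \<le> measure (\<mu>0 i) S + e"
      by (rule unif_leD)
    then show "\<forall>\<^sub>F n in sequentially. \<forall>i\<in>I. - measure (\<mu> n i) S \<le> - measure (\<mu>0 i) S + e"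
    proof eventually_elim
      case (elim n)
      show ?case
      proof
        fix i assume i: "i \<in> I"
        show "- measure (\<mu> n i) S \<le> - measure (\<mu>0 i) S + e"
          using bspec[OF elim lim.c_closed[OF i]] lim.mass_c[OF i] seq.mass_c[OF i, of n] by linarith
      qed
    qed
  qed
  ultimately show mass_cond by (simp add: mass_cond_def uniform_limit_iff_unif_le)
qed (simp add: mass_cond_def uniform_limit_iff_unif_le)

lemma mass_cond_iff_lower:
  "mass_cond \<longleftrightarrow> unif_le I (\<lambda>n i. - measure (\<mu> n i) S) (\<lambda>i. - measure (\<mu>0 i) S)"
proof
  assume *: "unif_le I (\<lambda>n i. - measure (\<mu> n i) S) (\<lambda>i. - measure (\<mu>0 i) S)"
  show mass_cond
    unfolding mass_cond_iff_upper
  proof (rule unif_leI)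
    fix e :: real assume "e > 0"
    with * have "\<forall>\<^sub>F n in sequentially. \<forall>i\<in>I. - measure (\<mu> n i) S \<le> - measure (\<mu>0 i) S + e"
      by (rule unif_leD)
    then show "\<forall>\<^sub>F n in sequentially. \<forall>i\<in>I. measure (\<mu> n i) S \<le> measure (\<mu>0 i) S + e"
    proof eventually_elim
      case (elim n)
      show ?case
      proof
        fix i assume i: "i \<in> I"
        show "measure (\<mu> n i) S \<le> measure (\<mu>0 i) S + e"
          using bspec[OF elim lim.c_closed[OF i]] lim.mass_c[OF i] seq.mass_c[OF i, of n] by linarith
      qed
    qed
  qed
qed (simp add: mass_cond_def uniform_limit_iff_unif_le)

lemma mass_condD:
  assumes mass_cond
  shows "unif_le I (\<lambda>n i. measure (\<mu> n i) S) (\<lambda>i. measure (\<mu>0 i) S)"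
    and "unif_le I (\<lambda>n i. - measure (\<mu> n i) S) (\<lambda>i. - measure (\<mu>0 i) S)"
  using assms by (auto simp: mass_cond_def uniform_limit_iff_unif_le)

lemma open_cond_imp_mass_cond: "open_cond \<Longrightarrow> mass_cond"
  by (auto simp: open_cond_def mass_cond_iff_lower)

lemma closed_cond_imp_mass_cond: "closed_cond \<Longrightarrow> mass_cond"
  by (auto simp: closed_cond_def mass_cond_iff_upper)

lemma measure_complement:
  assumes "A \<in> sets (borel_on S)" "i \<in> I"
  shows "measure (\<mu>0 i) (S - A) = measure (\<mu>0 i) S - measure (\<mu>0 i) A"
    and "measure (\<mu> n i) (S - A) = measure (\<mu> n i) S - measure (\<mu> n i) A"
  using assms finite_measure.finite_measure_compl[of "\<mu>0 i" A]
    finite_measure.finite_measure_compl[of "\<mu> n i" A]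
  by (auto simp: lim.finite_\<kappa> seq.finite_\<kappa> lim.sets_\<kappa> seq.sets_\<kappa> lim.space_\<kappa> seq.space_\<kappa>)

text \<open>Since \<open>- measure M (S - C) + measure M S = measure M C\<close>, adding the upper
  mass bound turns the statement for the open complement into the one for \<open>C\<close>. In the
  other direction the lower mass bound is added.\<close>

lemma open_cond_iff_closed_cond: "open_cond \<longleftrightarrow> closed_cond"
proof
  assume o: open_cond
  show closed_cond
    unfolding closed_cond_def
  proof (intro allI impI)
    fix C assume C: "closedin (top_of_set S) C"
    then have "openin (top_of_set S) (S - C)" by (metis openin_diff openin_subtopology_self)
    with o have "unif_le I (\<lambda>n i. - measure (\<mu> n i) (S - C)) (\<lambda>i. - measure (\<mu>0 i) (S - C))"
      by (simp add: open_cond_def)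
    from unif_le_add[OF this mass_condD(1)[OF open_cond_imp_mass_cond[OF o]]]
    show "unif_le I (\<lambda>n i. measure (\<mu> n i) C) (\<lambda>i. measure (\<mu>0 i) C)"
      by (rule iffD1[OF unif_le_cong, rotated -1])
        (simp_all add: measure_complement[OF sets_borel_on_closedin[OF C]])
  qed
next
  assume cl: closed_cond
  show open_cond
    unfolding open_cond_def
  proof (intro allI impI)
    fix U assume U: "openin (top_of_set S) U"
    then have "closedin (top_of_set S) (S - U)" by (metis closedin_diff closedin_subtopology_refl topspace_euclidean subset_UNIV)
    with cl have "unif_le I (\<lambda>n i. measure (\<mu> n i) (S - U)) (\<lambda>i. measure (\<mu>0 i) (S - U))"
      by (simp add: closed_cond_def)
    from unif_le_add[OF this mass_condD(2)[OF closed_cond_imp_mass_cond[OF cl]]]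
    show "unif_le I (\<lambda>n i. - measure (\<mu> n i) U) (\<lambda>i. - measure (\<mu>0 i) U)"
      by (rule iffD1[OF unif_le_cong, rotated -1])
        (simp_all add: measure_complement[OF sets_borel_on_openin[OF U]])
  qed
qed

text \<open>The closure bounds \<open>A\<close> from above and the interior bounds it from below.
  Both differ from \<open>A\<close> only inside the frontier, which is null for
  \<open>\<mu>0 j\<close> and by domination for every limit slice.\<close>

lemma closed_cond_imp_continuity_cond:
  assumes cl: closed_cond
  shows continuity_cond
  unfolding continuity_cond_def
proof (intro ballI impI)
  fix A assume A: "A \<in> sets (borel_on S)" and
    null: "measure (\<mu>0 j) (top_of_set S frontier_of A) = 0"
  let ?c = "top_of_set S closure_of A" and ?o = "top_of_set S interior_of A"
  let ?N = "top_of_set S frontier_of A"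
  have N: "?N \<in> sets (borel_on S)" by (intro sets_borel_on_closedin closedin_frontier_of)
  have c: "closedin (top_of_set S) ?c" and o: "openin (top_of_set S) ?o" by simp_all
  note c' = sets_borel_on_closedin[OF c] and o' = sets_borel_on_openin[OF o]
  have AS: "A \<subseteq> S" using sets.sets_into_space[OF A] by (simp add: space_restrict_space)
  have Ac: "A \<subseteq> ?c" using AS by (intro closure_of_subset) simp
  have oA: "?o \<subseteq> A" by (rule interior_of_subset)
  have 1: "?c \<subseteq> A \<union> ?N" "A \<subseteq> ?o \<union> ?N" using oA Ac by (auto simp: frontier_of_def)
  have "unif_le I (\<lambda>n i. measure (\<mu> n i) A) (\<lambda>i. measure (\<mu>0 i) A)"
  proof (rule unif_le_approx, intro exI conjI allI ballI)
    show "unif_le I (\<lambda>n i. measure (\<mu> n i) ?c) (\<lambda>i. measure (\<mu>0 i) ?c)"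
      using cl c by (simp add: closed_cond_def)
    show "measure (\<mu> n i) A \<le> measure (\<mu> n i) ?c" if "i \<in> I" for n i
      using that Ac c' by (rule seq.measure_\<kappa>_mono)
    show "measure (\<mu>0 i) ?c \<le> measure (\<mu>0 i) A + e" if "i \<in> I" "e > 0" for i e
      using that null by (intro lim.measure_\<kappa>_le_add[OF _ 1(1) A N]) auto
  qed
  moreover have "unif_le I (\<lambda>n i. - measure (\<mu> n i) A) (\<lambda>i. - measure (\<mu>0 i) A)"
  proof (rule unif_le_approx, intro exI conjI allI ballI)
    show "unif_le I (\<lambda>n i. - measure (\<mu> n i) ?o) (\<lambda>i. - measure (\<mu>0 i) ?o)"
      using cl o by (simp add: open_cond_iff_closed_cond[symmetric] open_cond_def)
    show "- measure (\<mu> n i) A \<le> - measure (\<mu> n i) ?o" if "i \<in> I" for n i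
      using seq.measure_\<kappa>_mono[OF that oA A] by simp
    show "- measure (\<mu>0 i) ?o \<le> - measure (\<mu>0 i) A + e" if "i \<in> I" "e > 0" for i e
      using lim.measure_\<kappa>_le_add[OF that(1) 1(2) o' N, of e] that(2) null by simp
  qed
  ultimately show "uniform_limit I (\<lambda>n i. measure (\<mu> n i) A) (\<lambda>i. measure (\<mu>0 i) A) sequentially"
    by (simp add: uniform_limit_iff_unif_le)
qed

text \<open>A closed set may have a frontier of positive mass, so it is replaced by a slightly
  larger distance neighbourhood whose frontier is null.\<close>

lemma continuity_cond_imp_closed_cond:
  assumes cc: continuity_cond
  shows closed_cond
  unfolding closed_cond_def
proof (intro allI impI)
  fix C assume C: "closedin (top_of_set S) C"
  note C' = sets_borel_on_closedin[OF C]
  interpret fin: finite_measure "\<mu>0 j" using lim.j_in by (rule lim.finite_\<kappa>)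
  show "unif_le I (\<lambda>n i. measure (\<mu> n i) C) (\<lambda>i. measure (\<mu>0 i) C)"
  \<comment> \<open>For empty \<open>C\<close> the function \<open>infdist x C\<close> is constantly
    0, and the neighbourhoods would be all of \<open>S\<close>.\<close>
  proof (cases "C = {}")
    case True
    then show ?thesis by (simp add: unif_le_const)
  next
    case False
    have CS: "C \<subseteq> S" using closedin_subset[OF C] by simp
    show ?thesis
    proof (rule unif_le_approx)
      fix e :: real assume "e > 0"
      let ?A = "\<lambda>r. {x\<in>S. infdist x C \<le> r}"
      note A' = sets_borel_on_closedin[OF closedin_infdist_le]
      obtain R where R: "R > 0" "measure (\<mu>0 j) (?A R - C) \<le> e"
        using measure_infdist_neighbourhood[OF fin.finite_measure_axioms lim.sets_\<kappa>[OF lim.j_in] C False \<open>e > 0\<close>]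
        by blast
      have "(\<lambda>x. infdist x C) \<in> borel_measurable (borel_on S)"
        by (intro borel_measurable_continuous_on_restrict continuous_intros)
      then have "(\<lambda>x. infdist x C) \<in> borel_measurable (\<mu>0 j)"
        by (simp cong: measurable_cong_sets add: lim.sets_\<kappa>[OF lim.j_in])
      \<comment> \<open>\<open>R\<close> controls the mass and \<open>r\<close> below
        \<open>R\<close> the frontier: a null sphere exists in the interval from 0 to
        \<open>R\<close>, though not necessarily at \<open>R\<close>.\<close>
      from finite_measure_null_level_set[OF fin.finite_measure_axioms this R(1)]
      obtain r where r: "0 < r" "r < R" "measure (\<mu>0 j) {x\<in>S. infdist x C = r} = 0"
        by (auto simp: lim.space_\<kappa>[OF lim.j_in])
      have "closed {x. infdist x C = r}" by (intro closed_Collect_eq continuous_intros)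
      moreover have "{x\<in>S. infdist x C = r} = S \<inter> {x. infdist x C = r}" by auto
      ultimately have "closedin (top_of_set S) {x\<in>S. infdist x C = r}" by (auto simp: closedin_closed)
      then have "{x\<in>S. infdist x C = r} \<in> sets (borel_on S)" by (rule sets_borel_on_closedin)
      then have "measure (\<mu>0 j) (top_of_set S frontier_of ?A r) \<le> 0"
        using lim.measure_\<kappa>_mono[OF lim.j_in frontier_of_infdist_le[of S C r]] r(3) by simp
      then have null: "measure (\<mu>0 j) (top_of_set S frontier_of ?A r) = 0"
        using measure_nonneg[of "\<mu>0 j"] by (simp add: order_antisym)
      show "\<exists>g' h'. unif_le I g' h' \<and> (\<forall>n. \<forall>i\<in>I. measure (\<mu> n i) C \<le> g' n i) \<and>
          (\<forall>i\<in>I. h' i \<le> measure (\<mu>0 i) C + e)"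
      proof (intro exI conjI allI ballI)
        show "unif_le I (\<lambda>n i. measure (\<mu> n i) (?A r)) (\<lambda>i. measure (\<mu>0 i) (?A r))"
          using cc A'[of S C r] null by (simp add: continuity_cond_def uniform_limit_iff_unif_le)
        show "measure (\<mu> n i) C \<le> measure (\<mu> n i) (?A r)" if "i \<in> I" for n i
          using that A' CS r(1) by (intro seq.measure_\<kappa>_mono) auto
        \<comment> \<open>The error set is taken at radius \<open>R\<close>, where its mass is known
          to be small; it contains \<open>?A r - C\<close> because \<open>r < R\<close>.\<close>
        show "measure (\<mu>0 i) (?A r) \<le> measure (\<mu>0 i) C + e" if "i \<in> I" for i
          using that r(2) C' A'[of S C R] R(2)
          by (intro lim.measure_\<kappa>_le_add[where N = "?A R - C"]) auto
      qed
    qed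
  qed
qed

text \<open>The superlevel sets of \<open>f\<close> are open. The layer sum \<open>g\<close>
  satisfies \<open>g <= f <= g + d\<close>: its first half serves the sequence, its second half the
  limit.\<close>

lemma open_cond_imp_lsc_cond:
  assumes o: open_cond
  shows lsc_cond
  unfolding lsc_cond_def
proof (intro allI impI, elim conjE)
  fix f :: "'a \<Rightarrow> real"
  assume nn: "\<forall>x\<in>S. 0 \<le> f x" and bdd: "bounded (f ` S)" and lsc: "lower_semicontinuous_on S f"
  obtain K where K: "K > 0" "\<And>x. x \<in> S \<Longrightarrow> \<bar>f x\<bar> \<le> K"
    using bdd by (auto simp: bounded_pos)
  define U where "U t = {x\<in>S. t < f x}" for t
  have U: "openin (top_of_set S) (U t)" for t
    unfolding U_def using lsc by (rule lower_semicontinuous_on_openin)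
  note U' = sets_borel_on_openin[OF U]
  note f = lower_semicontinuous_on_measurable[OF lsc]
  show "unif_le I (\<lambda>n i. - (LINT x|\<mu> n i. f x)) (\<lambda>i. - (LINT x|\<mu>0 i. f x))"
  proof (rule unif_le_approx)
    fix e :: real assume "e > 0"
    \<comment> \<open>Chosen so that \<open>m\<close> layers of height \<open>d = K / m\<close>
      reach the bound \<open>K\<close> of \<open>f\<close> and \<open>d\<close> is at most
      \<open>e\<close>.\<close>
    obtain m :: nat where "K / e < m" using reals_Archimedean2 by blast
    moreover from this K(1) \<open>e > 0\<close> have "m > 0"
      by (intro gr0I) (auto dest: less_asym simp: divide_less_0_iff)
    ultimately have m: "m > 0" "K / m \<le> e"
      using \<open>e > 0\<close> by (auto simp: field_simps)
    define d where "d = K / m"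
    have d: "d > 0" "d \<le> e" "real m * d = K" using m K(1) by (auto simp: d_def)
    define g where "g x = (\<Sum>k=1..m. d * indicator (U (real k * d)) x)" for x
    have g_eq: "g x = (\<Sum>k=1..m. d * of_bool (real k * d < f x))" if "x \<in> S" for x
      using that by (auto simp: g_def U_def indicator_def of_bool_def intro!: sum.cong)
    have g: "g x \<le> f x" "f x \<le> g x + d" if "x \<in> S" for x
      using layer_sum_bounds[OF d(1), of "f x" m] nn K(2)[OF that] that
      by (auto simp: g_eq d(3))
    have ig: "integrable \<kappa> g \<and> (LINT x|\<kappa>. g x) = (\<Sum>k=1..m. d * measure \<kappa> (U (real k * d)))"
      if "\<And>t. integrable \<kappa> (indicator (U t) :: 'a \<Rightarrow> real)"
         "\<And>t. (LINT x|\<kappa>. indicator (U t) x) = measure \<kappa> (U t)" for \<kappa>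
    proof
      show "integrable \<kappa> g"
        unfolding g_def by (intro Bochner_Integration.integrable_sum integrable_mult_right that)
      show "(LINT x|\<kappa>. g x) = (\<Sum>k=1..m. d * measure \<kappa> (U (real k * d)))"
        unfolding g_def
        by (subst Bochner_Integration.integral_sum)
          (simp_all only: integral_mult_right_zero that integrable_mult_right)
    qed
    have i0: "integrable (\<mu>0 i) g" "(LINT x|\<mu>0 i. g x) = (\<Sum>k=1..m. d * measure (\<mu>0 i) (U (real k * d)))"
      if "i \<in> I" for i
      using ig[OF lim.integral_\<kappa>_indicator[OF that U']] by auto
    have i1: "integrable (\<mu> n i) g" "(LINT x|\<mu> n i. g x) = (\<Sum>k=1..m. d * measure (\<mu> n i) (U (real k * d)))"
      if "i \<in> I" for n i
      using ig[OF seq.integral_\<kappa>_indicator[OF that U']] by auto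
    show "\<exists>g' h'. unif_le I g' h' \<and> (\<forall>n. \<forall>i\<in>I. - (LINT x|\<mu> n i. f x) \<le> g' n i) \<and>
        (\<forall>i\<in>I. h' i \<le> - (LINT x|\<mu>0 i. f x) + e)"
    proof (intro exI conjI allI ballI)
      \<comment> \<open>The minus sign stays inside the sum, so that each term is
        \<open>open_cond\<close> scaled by the nonnegative factor \<open>d\<close>.\<close>
      show "unif_le I (\<lambda>n i. \<Sum>k=1..m. d * - measure (\<mu> n i) (U (real k * d)))
          (\<lambda>i. \<Sum>k=1..m. d * - measure (\<mu>0 i) (U (real k * d)))"
        using o U d(1) unfolding open_cond_def by (intro unif_le_sum unif_le_cmult) auto
      show "- (LINT x|\<mu> n i. f x) \<le> (\<Sum>k=1..m. d * - measure (\<mu> n i) (U (real k * d)))"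
        if "i \<in> I" for n i
        using seq.integral_\<kappa>_le_add[OF that i1(1)[OF that] seq.integrable_\<kappa>[OF that f K(2)], of 0] g(1)
        by (simp add: i1(2)[OF that] sum_negf)
      show "(\<Sum>k=1..m. d * - measure (\<mu>0 i) (U (real k * d))) \<le> - (LINT x|\<mu>0 i. f x) + e"
        if "i \<in> I" for i
        using lim.integral_\<kappa>_le_add[OF that lim.integrable_\<kappa>[OF that f K(2)] i0(1)[OF that], of d] g(2) d
        by (simp add: i0(2)[OF that] sum_negf)
    qed
  qed
qed

text \<open>A continuous \<open>f\<close> bounded by \<open>K\<close> becomes nonnegative after
  adding \<open>K\<close>, which gives one inequality; the same argument for \<open>- f\<close>
  gives the other.\<close>

lemma lsc_cond_imp_weak_cond:
  assumes l: lsc_cond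
  shows weak_cond
  unfolding weak_cond_def
proof (intro allI impI, elim conjE)
  fix f :: "'a \<Rightarrow> real"
  assume f: "continuous_on S f" and bdd: "bounded (f ` S)"
  obtain K where K: "K > 0" "\<And>x. x \<in> S \<Longrightarrow> \<bar>f x\<bar> \<le> K"
    using bdd by (auto simp: bounded_pos)
  \<comment> \<open>The constant function 1 is admissible, and its integral is the total
    mass.\<close>
  have "unif_le I (\<lambda>n i. - (LINT x|\<mu> n i. 1)) (\<lambda>i. - (LINT x|\<mu>0 i. 1))"
    using l[unfolded lsc_cond_def, rule_format, of "\<lambda>_. 1"]
    by (simp add: image_constant_conv continuous_on_imp_lower_semicontinuous_on)
  then have mass: mass_cond
    unfolding mass_cond_iff_lower
    by (rule iffD1[OF unif_le_cong, rotated -1]) (simp_all add: lim.space_\<kappa> seq.space_\<kappa>)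
  have main: "unif_le I (\<lambda>n i. - (LINT x|\<mu> n i. h x)) (\<lambda>i. - (LINT x|\<mu>0 i. h x))"
    if h: "continuous_on S h" "\<And>x. x \<in> S \<Longrightarrow> \<bar>h x\<bar> \<le> K" for h :: "'a \<Rightarrow> real"
  proof -
    have hm: "h \<in> borel_measurable (borel_on S)"
      using h(1) by (rule borel_measurable_continuous_on_restrict)
    have "unif_le I (\<lambda>n i. - (LINT x|\<mu> n i. h x + K)) (\<lambda>i. - (LINT x|\<mu>0 i. h x + K))"
    proof -
      have "\<forall>x\<in>S. 0 \<le> h x + K" using h(2) by (force simp: abs_le_iff)
      moreover have "bounded ((\<lambda>x. h x + K) ` S)"
        unfolding bounded_iff using h(2) K(1) by (intro exI[of _ "2 * K"]) force
      moreover have "lower_semicontinuous_on S (\<lambda>x. h x + K)"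
        using h(1) by (intro continuous_on_imp_lower_semicontinuous_on continuous_intros)
      ultimately show ?thesis using l by (simp add: lsc_cond_def)
    qed
    \<comment> \<open>The shift changes the integral by \<open>K\<close> times a mass that varies
      with \<open>n\<close> and \<open>i\<close>; adding this upper bound cancels it.\<close>
    moreover have "unif_le I (\<lambda>n i. K * measure (\<mu> n i) S) (\<lambda>i. K * measure (\<mu>0 i) S)"
      using mass_condD(1)[OF mass] K(1) by (intro unif_le_cmult) auto
    ultimately have "unif_le I (\<lambda>n i. - (LINT x|\<mu> n i. h x + K) + K * measure (\<mu> n i) S)
        (\<lambda>i. - (LINT x|\<mu>0 i. h x + K) + K * measure (\<mu>0 i) S)"
      by (rule unif_le_add)
    moreover have "(LINT x|\<mu>0 i. h x + K) = (LINT x|\<mu>0 i. h x) + K * measure (\<mu>0 i) S" if "i \<in> I" for i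
    proof -
      interpret finite_measure "\<mu>0 i" using that by (rule lim.finite_\<kappa>)
      show ?thesis using lim.integrable_\<kappa>[OF that hm h(2)] by (simp add: lim.space_\<kappa>[OF that])
    qed
    moreover have "(LINT x|\<mu> n i. h x + K) = (LINT x|\<mu> n i. h x) + K * measure (\<mu> n i) S" if "i \<in> I" for n i
    proof -
      interpret finite_measure "\<mu> n i" using that by (rule seq.finite_\<kappa>)
      show ?thesis using seq.integrable_\<kappa>[OF that hm h(2)] by (simp add: seq.space_\<kappa>[OF that])
    qed
    ultimately show ?thesis
      by (elim iffD1[OF unif_le_cong, rotated -1]) simp_all
  qed
  \<comment> \<open>This is the upper bound for the integral of \<open>f\<close> itself.\<close>
  have "unif_le I (\<lambda>n i. - (LINT x|\<mu> n i. - f x)) (\<lambda>i. - (LINT x|\<mu>0 i. - f x))"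
    using f K(2) by (intro main continuous_intros) auto
  with main[OF f K(2)]
  show "uniform_limit I (\<lambda>n i. LINT x|\<mu> n i. f x) (\<lambda>i. LINT x|\<mu>0 i. f x) sequentially"
    by (simp add: uniform_limit_iff_unif_le)
qed

text \<open>A continuous function between the indicators of \<open>C\<close> and of a neighbourhood
  of small excess mass stands in for the indicator of \<open>C\<close>.\<close>

lemma weak_cond_imp_closed_cond:
  assumes w: weak_cond
  shows closed_cond
  unfolding closed_cond_def
proof (intro allI impI)
  fix C assume C: "closedin (top_of_set S) C"
  note C' = sets_borel_on_closedin[OF C]
  interpret fin: finite_measure "\<mu>0 j" using lim.j_in by (rule lim.finite_\<kappa>)
  show "unif_le I (\<lambda>n i. measure (\<mu> n i) C) (\<lambda>i. measure (\<mu>0 i) C)"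
  proof (cases "C = {}")
    case True
    then show ?thesis by (simp add: unif_le_const)
  next
    case False
    show ?thesis
    proof (rule unif_le_approx)
      fix e :: real assume "e > 0"
      let ?A = "\<lambda>r. {x\<in>S. infdist x C \<le> r}"
      obtain r where r: "r > 0" "measure (\<mu>0 j) (?A r - C) \<le> e"
        using measure_infdist_neighbourhood[OF fin.finite_measure_axioms lim.sets_\<kappa>[OF lim.j_in] C False \<open>e > 0\<close>]
        by blast
      note A' = sets_borel_on_closedin[OF closedin_infdist_le[of S C r]]
      \<comment> \<open>Equal to 1 on \<open>C\<close>, falling linearly in the distance, and 0 from
        distance \<open>r\<close> on.\<close>
      define f where "f x = max 0 (1 - infdist x C / r)" for x
      have f: "continuous_on S f" unfolding f_def using r(1) by (intro continuous_intros) auto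
      have f_bound: "\<bar>f x\<bar> \<le> 1" for x
        using r(1) infdist_nonneg[of x C] by (auto simp: f_def)
      have fm: "f \<in> borel_measurable (borel_on S)"
        using f by (rule borel_measurable_continuous_on_restrict)
      have fC: "indicator C x \<le> f x" for x
        by (auto simp: f_def indicator_def)
      have fA: "f x \<le> indicator (?A r) x" if "x \<in> S" for x
        using that r(1) infdist_nonneg[of x C] by (auto simp: f_def indicator_def not_le)
      show "\<exists>g' h'. unif_le I g' h' \<and> (\<forall>n. \<forall>i\<in>I. measure (\<mu> n i) C \<le> g' n i) \<and>
          (\<forall>i\<in>I. h' i \<le> measure (\<mu>0 i) C + e)"
      proof (intro exI conjI allI ballI)
        have "bounded (f ` S)" using f_bound by (auto simp: bounded_iff)
        then show "unif_le I (\<lambda>n i. LINT x|\<mu> n i. f x) (\<lambda>i. LINT x|\<mu>0 i. f x)"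
          using w f by (simp add: weak_cond_def uniform_limit_iff_unif_le)
        show "measure (\<mu> n i) C \<le> (LINT x|\<mu> n i. f x)" if "i \<in> I" for n i
        proof -
          have "(LINT x|\<mu> n i. indicator C x) \<le> (LINT x|\<mu> n i. f x) + 0"
            using that seq.integral_\<kappa>_indicator(1)[OF that C'] seq.integrable_\<kappa>[OF that fm f_bound]
            by (rule seq.integral_\<kappa>_le_add) (use fC in auto)
          then show ?thesis
            by (simp only: seq.integral_\<kappa>_indicator(2)[OF that C'] add_0_right)
        qed
        show "(LINT x|\<mu>0 i. f x) \<le> measure (\<mu>0 i) C + e" if i: "i \<in> I" for i
        proof -
          have "(LINT x|\<mu>0 i. f x) \<le> measure (\<mu>0 i) (?A r)"
          proof -
            have "(LINT x|\<mu>0 i. f x) \<le> (LINT x|\<mu>0 i. indicator (?A r) x) + 0"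
              using i lim.integrable_\<kappa>[OF i fm f_bound] lim.integral_\<kappa>_indicator(1)[OF i A']
              by (rule lim.integral_\<kappa>_le_add) (use fA in auto)
            then show ?thesis
              by (simp only: lim.integral_\<kappa>_indicator(2)[OF i A'] add_0_right)
          qed
          also have "\<dots> \<le> measure (\<mu>0 i) C + e"
            using i C' A' r(2) by (intro lim.measure_\<kappa>_le_add[where N = "?A r - C"]) auto
          finally show ?thesis .
        qed
      qed
    qed
  qed
qed

text \<open>Everything passes through \<open>closed_cond\<close>: it is equivalent to
  \<open>open_cond\<close> and to \<open>continuity_cond\<close>, and the circle closes through
  \<open>lsc_cond\<close> and \<open>weak_cond\<close>.\<close>

theorem equivalences:
  "weak_cond \<longleftrightarrow> open_cond" "weak_cond \<longleftrightarrow> closed_cond"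
  "weak_cond \<longleftrightarrow> continuity_cond" "weak_cond \<longleftrightarrow> lsc_cond" "weak_cond \<Longrightarrow> mass_cond"
  using open_cond_iff_closed_cond closed_cond_imp_continuity_cond continuity_cond_imp_closed_cond
    open_cond_imp_lsc_cond lsc_cond_imp_weak_cond weak_cond_imp_closed_cond closed_cond_imp_mass_cond
  by blast+

end

section \<open>Slices of a stochastic kernel on a product\<close>

lemma sets_slice_measure: "sets (slice_measure S \<mu> B) = sets (borel_on S)"
  using sets.sigma_sets_eq[of "borel_on S"]
  by (subst slice_measure_def, subst sets_measure_of) (auto simp: sets_restrict_space space_restrict_space)

lemma measure_slice_measure:
  fixes S1 :: "'a::second_countable_topology set" and S2 :: "'b::second_countable_topology set"
  assumes "sets \<mu> = sets (borel_on (S1 \<times> S2))" "A \<in> sets (borel_on S1)" "B \<in> sets (borel_on S2)"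
  shows "measure (slice_measure S1 \<mu> B) A = measure \<mu> (A \<times> B)"
  by (simp add: measure_def emeasure_slice_measure[OF assms])

lemma slice_family_slice_measure:
  fixes S1 :: "'a::{metric_space,second_countable_topology} set"
    and S2 :: "'b::second_countable_topology set"
  assumes "prob_space \<mu>" and sets: "sets \<mu> = sets (borel_on (S1 \<times> S2))"
  shows "slice_family S1 (sets (borel_on S2)) (\<lambda>B. S2 - B) S2 (slice_measure S1 \<mu>)"
proof -
  interpret prob_space \<mu> by fact
  have S1: "S1 \<in> sets (borel_on S1)" and S2: "S2 \<in> sets (borel_on S2)"
    using sets.top[of "borel_on S1"] sets.top[of "borel_on S2"] by (simp_all add: space_restrict_space)
  have sp: "space \<mu> = S1 \<times> S2"
    using sets_eq_imp_space_eq[OF sets] by (simp add: space_restrict_space)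
  note m = measure_slice_measure[OF sets]
  show ?thesis
  proof (rule slice_family.intro)
    fix B assume B: "B \<in> sets (borel_on S2)"
    then have BS: "B \<subseteq> S2" using sets.sets_into_space[of B "borel_on S2"] by (simp add: space_restrict_space)
    have "space (slice_measure S1 \<mu> B) = S1"
      using sets_eq_imp_space_eq[OF sets_slice_measure] by (simp add: space_restrict_space)
    then show "finite_measure (slice_measure S1 \<mu> B)"
      by (intro finite_measureI) (simp add: emeasure_slice_measure[OF sets S1 B])
    show "sets (slice_measure S1 \<mu> B) = sets (borel_on S1)" by (rule sets_slice_measure)
    show Bc: "S2 - B \<in> sets (borel_on S2)" using S2 B by (rule sets.Diff)
    have "prob (S1 \<times> B) + prob (S1 \<times> (S2 - B)) = prob (S1 \<times> B \<union> S1 \<times> (S2 - B))"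
      using S1 B Bc by (subst finite_measure_Union) (auto simp: sets intro!: Times_in_borel_on)
    also have "S1 \<times> B \<union> S1 \<times> (S2 - B) = space \<mu>" using BS sp by auto
    finally show "measure (slice_measure S1 \<mu> B) S1 + measure (slice_measure S1 \<mu> (S2 - B)) S1 = 1"
      by (simp add: m[OF S1 B] m[OF S1 Bc] prob_space)
    fix A assume A: "A \<in> sets (borel_on S1)"
    show "measure (slice_measure S1 \<mu> B) A \<le> measure (slice_measure S1 \<mu> S2) A"
      unfolding m[OF A B] m[OF A S2]
      using A S2 BS by (intro finite_measure_mono) (auto simp: sets intro!: Times_in_borel_on)
  qed (rule S2)
qed

section \<open>Kernels along convergent sequences\<close>

locale product_kernel =
  fixes S1 :: "'a::{metric_space,second_countable_topology} set"
    and S2 :: "'b::{metric_space,second_countable_topology} set"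
    and S3 :: "'c::metric_space set" and \<Psi> :: "'c \<Rightarrow> ('a \<times> 'b) measure"
  assumes kernel: "stochastic_kernel (S1 \<times> S2) S3 \<Psi>"
begin

lemma sets_\<Psi>: "t \<in> S3 \<Longrightarrow> sets (\<Psi> t) = sets (borel_on (S1 \<times> S2))"
  using kernel by (auto simp: stochastic_kernel_def)

lemma slice_family: "t \<in> S3 \<Longrightarrow>
    slice_family S1 (sets (borel_on S2)) (\<lambda>B. S2 - B) S2 (slice_measure S1 (\<Psi> t))"
  using kernel by (intro slice_family_slice_measure) (auto simp: stochastic_kernel_def)

lemmas measure_slice = measure_slice_measure[OF sets_\<Psi>]

text \<open>Kept literally equal to the antecedent of the sequential definitions, so that
  \<open>approach_def[symmetric]\<close> can fold it there.\<close>

definition approach :: "(nat \<Rightarrow> 'c) \<Rightarrow> 'c \<Rightarrow> bool" where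
  "approach s t \<longleftrightarrow> (\<forall>n. s n \<in> S3) \<and> t \<in> S3 \<and> s \<longlonglongrightarrow> t"

lemma approachD: "approach s t \<Longrightarrow> s n \<in> S3" "approach s t \<Longrightarrow> t \<in> S3"
  by (auto simp: approach_def)

lemma portmanteau:
  assumes "approach s t"
  shows "uniform_portmanteau S1 (sets (borel_on S2)) (\<lambda>B. S2 - B) S2
    (slice_measure S1 (\<Psi> t)) (\<lambda>n. slice_measure S1 (\<Psi> (s n)))"
  using approachD[OF assms]
  by (simp add: uniform_portmanteau_def uniform_portmanteau_axioms_def slice_family)

text \<open>Outside the locale a condition takes only the parameters that its body mentions; of
  these conditions only \<open>continuity\<close> refers to the top index \<open>S2\<close>.\<close>

abbreviation "weak s t \<equiv> uniform_portmanteau.weak_cond S1 (sets (borel_on S2))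
    (slice_measure S1 (\<Psi> t)) (\<lambda>n. slice_measure S1 (\<Psi> (s n)))"

abbreviation "opens s t \<equiv> uniform_portmanteau.open_cond S1 (sets (borel_on S2))
    (slice_measure S1 (\<Psi> t)) (\<lambda>n. slice_measure S1 (\<Psi> (s n)))"

abbreviation "closeds s t \<equiv> uniform_portmanteau.closed_cond S1 (sets (borel_on S2))
    (slice_measure S1 (\<Psi> t)) (\<lambda>n. slice_measure S1 (\<Psi> (s n)))"

abbreviation "continuity s t \<equiv> uniform_portmanteau.continuity_cond S1 (sets (borel_on S2)) S2
    (slice_measure S1 (\<Psi> t)) (\<lambda>n. slice_measure S1 (\<Psi> (s n)))"

abbreviation "lsc s t \<equiv> uniform_portmanteau.lsc_cond S1 (sets (borel_on S2))
    (slice_measure S1 (\<Psi> t)) (\<lambda>n. slice_measure S1 (\<Psi> (s n)))"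

abbreviation "mass s t \<equiv> uniform_portmanteau.mass_cond S1 (sets (borel_on S2))
    (slice_measure S1 (\<Psi> t)) (\<lambda>n. slice_measure S1 (\<Psi> (s n)))"

text \<open>Provides the upper bounds that make the real-valued suprema meaningful.\<close>

lemma abs_diff_measure_le_1:
  assumes "approach s t" "A \<in> sets (borel_on S1)" "B \<in> sets (borel_on S2)"
  shows "\<bar>measure (\<Psi> (s n)) (A \<times> B) - measure (\<Psi> t) (A \<times> B)\<bar> \<le> 1"
proof -
  interpret uniform_portmanteau S1 "sets (borel_on S2)" "\<lambda>B. S2 - B" S2
    "slice_measure S1 (\<Psi> t)" "\<lambda>n. slice_measure S1 (\<Psi> (s n))"
    using assms(1) by (rule portmanteau)
  show ?thesis
    using lim.measure_\<kappa>_bounds[OF assms(3,2)] seq.measure_\<kappa>_bounds[OF assms(3,2), of n]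
      approachD[OF assms(1)] assms(2,3)
    by (simp add: measure_slice) (smt (verit) measure_nonneg)
qed

section \<open>Each condition on the kernel as a condition on its slices\<close>

lemma SUP_abs_diff_iff:
  assumes st: "approach s t" and A: "A \<in> sets (borel_on S1)"
  shows "(\<lambda>n. SUP B\<in>sets (borel_on S2).
      \<bar>measure (\<Psi> (s n)) (A \<times> B) - measure (\<Psi> t) (A \<times> B)\<bar>) \<longlonglongrightarrow> 0 \<longleftrightarrow>
    uniform_limit (sets (borel_on S2)) (\<lambda>n B. measure (slice_measure S1 (\<Psi> (s n)) B) A)
      (\<lambda>B. measure (slice_measure S1 (\<Psi> t) B) A) sequentially"
proof -
  have "bdd_above ((\<lambda>B. \<bar>measure (\<Psi> (s n)) (A \<times> B) - measure (\<Psi> t) (A \<times> B)\<bar>) ` sets (borel_on S2))" for n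
    using abs_diff_measure_le_1[OF st A] by (auto simp: bdd_above_def)
  then have "(\<lambda>n. SUP B\<in>sets (borel_on S2).
      \<bar>measure (\<Psi> (s n)) (A \<times> B) - measure (\<Psi> t) (A \<times> B)\<bar>) \<longlonglongrightarrow> 0 \<longleftrightarrow>
      unif_le (sets (borel_on S2))
        (\<lambda>n B. \<bar>measure (\<Psi> (s n)) (A \<times> B) - measure (\<Psi> t) (A \<times> B)\<bar>) (\<lambda>_. 0)"
    by (intro SUP_tendsto_0_iff[where j = "{}"]) auto
  also have "\<dots> \<longleftrightarrow> unif_le (sets (borel_on S2))
      (\<lambda>n B. \<bar>measure (slice_measure S1 (\<Psi> (s n)) B) A - measure (slice_measure S1 (\<Psi> t) B) A\<bar>) (\<lambda>_. 0)"
    using A approachD[OF st] by (intro unif_le_cong) (simp_all add: measure_slice)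
  finally show ?thesis by (simp add: unif_le_abs_diff_0_iff)
qed

lemma semi_uniform_Feller_iff:
  "semi_uniform_Feller S1 S2 S3 \<Psi> \<longleftrightarrow> (\<forall>s t. approach s t \<longrightarrow> weak s t)"
proof -
  have "(\<lambda>n. SUP B\<in>sets (borel_on S2).
      \<bar>(LINT x|slice_measure S1 (\<Psi> (s n)) B. f x) - (LINT x|slice_measure S1 (\<Psi> t) B. f x)\<bar>) \<longlonglongrightarrow> 0 \<longleftrightarrow>
    uniform_limit (sets (borel_on S2)) (\<lambda>n B. LINT x|slice_measure S1 (\<Psi> (s n)) B. f x)
      (\<lambda>B. LINT x|slice_measure S1 (\<Psi> t) B. f x) sequentially"
    if st: "approach s t" and f: "continuous_on S1 f" "bounded (f ` S1)" for s t and f :: "'a \<Rightarrow> real"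
  proof -
    interpret uniform_portmanteau S1 "sets (borel_on S2)" "\<lambda>B. S2 - B" S2
      "slice_measure S1 (\<Psi> t)" "\<lambda>n. slice_measure S1 (\<Psi> (s n))"
      using st by (rule portmanteau)
    obtain K where K: "K > 0" "\<And>x. x \<in> S1 \<Longrightarrow> \<bar>f x\<bar> \<le> K"
      using f(2) by (auto simp: bounded_pos)
    have fm: "f \<in> borel_measurable (borel_on S1)"
      using f(1) by (rule borel_measurable_continuous_on_restrict)
    have "\<bar>(LINT x|slice_measure S1 (\<Psi> (s n)) B. f x) - (LINT x|slice_measure S1 (\<Psi> t) B. f x)\<bar> \<le> 2 * K"
      if "B \<in> sets (borel_on S2)" for n B
      using lim.abs_integral_\<kappa>_le[OF that fm K(2)] seq.abs_integral_\<kappa>_le[OF that fm K(2), of n] K(1)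
      by linarith
    then have "bdd_above ((\<lambda>B. \<bar>(LINT x|slice_measure S1 (\<Psi> (s n)) B. f x)
        - (LINT x|slice_measure S1 (\<Psi> t) B. f x)\<bar>) ` sets (borel_on S2))" for n
      by (auto simp: bdd_above_def)
    then show ?thesis
      by (subst SUP_tendsto_0_iff[where j = "{}"]) (auto simp: unif_le_abs_diff_0_iff)
  qed
  then show ?thesis
    unfolding semi_uniform_Feller_def
    by (simp add: uniform_portmanteau.weak_cond_def[OF portmanteau] approach_def) blast
qed

lemma continuity_set_condition_iff:
  "continuity_set_condition S1 S2 S3 \<Psi> \<longleftrightarrow> (\<forall>s t. approach s t \<longrightarrow> continuity s t)"
proof -
  have "measure (slice_measure S1 (\<Psi> t) S2) (top_of_set S1 frontier_of A) =
      measure (\<Psi> t) ((top_of_set S1 frontier_of A) \<times> S2)" if "t \<in> S3" for t A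
    using that sets.top[of "borel_on S2"]
    by (intro measure_slice sets_borel_on_closedin closedin_frontier_of) (simp_all add: space_restrict_space)
  then show ?thesis
    unfolding continuity_set_condition_def approach_def[symmetric]
    by (auto simp: uniform_portmanteau.continuity_cond_def[OF portmanteau] SUP_abs_diff_iff approachD)
qed

lemma closed_set_condition_iff:
  "closed_set_condition S1 S2 S3 \<Psi> \<longleftrightarrow> (\<forall>s t. approach s t \<longrightarrow> closeds s t)"
proof -
  have "(\<lambda>n. SUP B\<in>sets (borel_on S2). measure (\<Psi> (s n)) (C \<times> B) - measure (\<Psi> t) (C \<times> B)) \<longlonglongrightarrow> 0 \<longleftrightarrow>
    unif_le (sets (borel_on S2)) (\<lambda>n B. measure (slice_measure S1 (\<Psi> (s n)) B) C)
      (\<lambda>B. measure (slice_measure S1 (\<Psi> t) B) C)"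
    if st: "approach s t" and C: "closedin (top_of_set S1) C" for s t C
  proof -
    note C' = sets_borel_on_closedin[OF C]
    have "bdd_above ((\<lambda>B. measure (\<Psi> (s n)) (C \<times> B) - measure (\<Psi> t) (C \<times> B)) ` sets (borel_on S2))" for n
      using abs_diff_measure_le_1[OF st C'] by (auto simp: bdd_above_def abs_le_iff)
    then have "(\<lambda>n. SUP B\<in>sets (borel_on S2). measure (\<Psi> (s n)) (C \<times> B) - measure (\<Psi> t) (C \<times> B)) \<longlonglongrightarrow> 0 \<longleftrightarrow>
        unif_le (sets (borel_on S2)) (\<lambda>n B. measure (\<Psi> (s n)) (C \<times> B)) (\<lambda>B. measure (\<Psi> t) (C \<times> B))"
      \<comment> \<open>Signed differences may all be negative for nonempty \<open>B\<close>; the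
        value 0 at the empty set keeps the supremum from dropping below 0.\<close>
      by (subst SUP_tendsto_0_iff[where j = "{}"]) (auto simp: unif_le_diff_0_iff)
    also have "\<dots> \<longleftrightarrow> unif_le (sets (borel_on S2)) (\<lambda>n B. measure (slice_measure S1 (\<Psi> (s n)) B) C)
        (\<lambda>B. measure (slice_measure S1 (\<Psi> t) B) C)"
      using C' approachD[OF st] by (intro unif_le_cong) (simp_all add: measure_slice)
    finally show ?thesis .
  qed
  then show ?thesis
    unfolding closed_set_condition_def approach_def[symmetric]
    by (auto simp: uniform_portmanteau.closed_cond_def[OF portmanteau])
qed

lemma lower_semicontinuous_condition_iff:
  "lower_semicontinuous_condition S1 S2 S3 \<Psi> \<longleftrightarrow> (\<forall>s t. approach s t \<longrightarrow> lsc s t)"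
proof -
  have "liminf (\<lambda>n. INF B\<in>sets (borel_on S2).
      ereal ((LINT x|slice_measure S1 (\<Psi> (s n)) B. f x) - (LINT x|slice_measure S1 (\<Psi> t) B. f x))) = 0 \<longleftrightarrow>
    unif_le (sets (borel_on S2)) (\<lambda>n B. - (LINT x|slice_measure S1 (\<Psi> (s n)) B. f x))
      (\<lambda>B. - (LINT x|slice_measure S1 (\<Psi> t) B. f x))"
    if st: "approach s t" for s t and f :: "'a \<Rightarrow> real"
  proof -
    let ?d = "\<lambda>n B. (LINT x|slice_measure S1 (\<Psi> (s n)) B. f x) - (LINT x|slice_measure S1 (\<Psi> t) B. f x)"
    \<comment> \<open>The slice at the empty set is the null measure, so this holds for every
      \<open>f\<close>, measurable or not. It makes the infimum at most 0, and the required equality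
      with 0 becomes the inequality \<open>0 <=\<close>.\<close>
    have "(LINT x|slice_measure S1 (\<Psi> u) {}. f x) = 0" if u: "u \<in> S3" for u
    proof -
      have "emeasure (slice_measure S1 (\<Psi> u) {}) (space (slice_measure S1 (\<Psi> u) {})) = 0"
        using sets.top[of "slice_measure S1 (\<Psi> u) {}"]
        by (subst emeasure_slice_measure[OF sets_\<Psi>[OF u]]) (simp_all add: sets_slice_measure)
      then have "AE x in slice_measure S1 (\<Psi> u) {}. f x = 0"
        by (intro AE_I[where N = "space (slice_measure S1 (\<Psi> u) {})"]) auto
      then show ?thesis by (rule integral_eq_zero_AE)
    qed
    then have "?d n {} = 0" for n using approachD[OF st] by simp
    then have "(INF B\<in>sets (borel_on S2). ereal (?d n B)) \<le> 0" for n
      by (intro INF_lower2[of "{}"]) auto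
    then have "liminf (\<lambda>n. INF B\<in>sets (borel_on S2). ereal (?d n B)) \<le> liminf (\<lambda>n. 0)"
      by (intro Liminf_mono) simp
    then have "liminf (\<lambda>n. INF B\<in>sets (borel_on S2). ereal (?d n B)) = 0 \<longleftrightarrow>
        0 \<le> liminf (\<lambda>n. INF B\<in>sets (borel_on S2). ereal (?d n B))"
      by (simp add: Liminf_const order_antisym_conv)
    then show ?thesis by (simp add: Liminf_INF_nonneg_iff unif_le_def algebra_simps)
  qed
  then show ?thesis
    unfolding lower_semicontinuous_condition_def approach_def[symmetric]
    by (auto simp: uniform_portmanteau.lsc_cond_def[OF portmanteau])
qed

lemma WTV_continuous_iff:
  "WTV_continuous S1 S2 S3 \<Psi> \<longleftrightarrow> (\<forall>s t. approach s t \<longrightarrow> opens s t)"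
proof -
  have fam: "lower_semi_equicontinuous S3 {\<lambda>s. measure (\<Psi> s) (U \<times> B) | B. B \<in> sets (borel_on S2)} \<longleftrightarrow>
    (\<forall>s t. approach s t \<longrightarrow>
      unif_le (sets (borel_on S2)) (\<lambda>n B. - measure (slice_measure S1 (\<Psi> (s n)) B) U)
        (\<lambda>B. - measure (slice_measure S1 (\<Psi> t) B) U))"
    if "openin (top_of_set S1) U" for U
  proof -
    note U' = sets_borel_on_openin[OF that]
    \<comment> \<open>As an image, the set of functions lets the infimum over functions become one
      over \<open>B\<close>.\<close>
    have "{\<lambda>s. measure (\<Psi> s) (U \<times> B) | B. B \<in> sets (borel_on S2)} =
        (\<lambda>B s. measure (\<Psi> s) (U \<times> B)) ` sets (borel_on S2)" by auto
    then have "lower_semi_equicontinuous S3 {\<lambda>s. measure (\<Psi> s) (U \<times> B) | B. B \<in> sets (borel_on S2)} \<longleftrightarrow>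
        (\<forall>t\<in>S3. \<forall>e>0. \<forall>\<^sub>F s in at t within S3. \<forall>B\<in>sets (borel_on S2).
          - e \<le> measure (\<Psi> s) (U \<times> B) - measure (\<Psi> t) (U \<times> B))"
      by (simp add: lower_semi_equicontinuous_def image_image Liminf_INF_nonneg_iff)
    also have "\<dots> \<longleftrightarrow> (\<forall>t\<in>S3. \<forall>e>0. \<forall>s. (\<forall>n. s n \<in> S3) \<and> s \<longlonglongrightarrow> t \<longrightarrow>
        (\<forall>\<^sub>F n in sequentially. \<forall>B\<in>sets (borel_on S2).
          - e \<le> measure (\<Psi> (s n)) (U \<times> B) - measure (\<Psi> t) (U \<times> B)))"
      \<comment> \<open>The side condition at the limit point itself is
        \<open>- e <= 0\<close>.\<close>
      by (intro ball_cong refl all_cong eventually_at_within_iff_sequentially) simp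
    also have "\<dots> \<longleftrightarrow> (\<forall>s t. approach s t \<longrightarrow>
        unif_le (sets (borel_on S2)) (\<lambda>n B. - measure (\<Psi> (s n)) (U \<times> B)) (\<lambda>B. - measure (\<Psi> t) (U \<times> B)))"
      unfolding unif_le_def approach_def by (auto simp: algebra_simps)
    finally show ?thesis
      using unif_le_cong[of "sets (borel_on S2)" "\<lambda>n B. - measure (\<Psi> (s n)) (U \<times> B)"
          "\<lambda>n B. - measure (slice_measure S1 (\<Psi> (s n)) B) U" "\<lambda>B. - measure (\<Psi> t) (U \<times> B)"
          "\<lambda>B. - measure (slice_measure S1 (\<Psi> t) B) U" for s t]
      using U' by (simp add: measure_slice approachD)
  qed
  show ?thesis
    unfolding WTV_continuous_def
    by (auto simp: uniform_portmanteau.open_cond_def[OF portmanteau] fam)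
qed

lemma continuous_in_total_variation_iff:
  "continuous_in_total_variation S2 S3 (snd_marginal S2 \<Psi>) \<longleftrightarrow> (\<forall>s t. approach s t \<longrightarrow> mass s t)"
proof -
  have S1: "S1 \<in> sets (borel_on S1)" by (rule sets_borel_on_openin) simp
  have "measure (snd_marginal S2 \<Psi> u) B = measure (\<Psi> u) (S1 \<times> B)"
    if "u \<in> S3" "B \<in> sets (borel_on S2)" for u B
    using emeasure_snd_marginal[of \<Psi> u S1 S2 B, OF sets_\<Psi>] that by (simp add: measure_def)
  then have "(\<lambda>n. SUP B\<in>sets (borel_on S2).
      \<bar>measure (snd_marginal S2 \<Psi> (s n)) B - measure (snd_marginal S2 \<Psi> t) B\<bar>) =
    (\<lambda>n. SUP B\<in>sets (borel_on S2). \<bar>measure (\<Psi> (s n)) (S1 \<times> B) - measure (\<Psi> t) (S1 \<times> B)\<bar>)"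
    if "approach s t" for s t
    using approachD[OF that] by (intro ext SUP_cong) auto
  then show ?thesis
    unfolding continuous_in_total_variation_def approach_def[symmetric]
    by (auto simp: uniform_portmanteau.mass_cond_def[OF portmanteau] SUP_abs_diff_iff[OF _ S1])
qed

end

theorem theorem3:
  fixes S1 :: "'a::polish_space set" and S2 :: "'b::polish_space set"
    and S3 :: "'c::polish_space set" and \<Psi> :: "'c \<Rightarrow> ('a \<times> 'b) measure"
  assumes "S1 \<in> sets borel" and "S2 \<in> sets borel" and "S3 \<in> sets borel"
    and "stochastic_kernel (S1 \<times> S2) S3 \<Psi>"
  shows "(semi_uniform_Feller S1 S2 S3 \<Psi> \<longleftrightarrow> WTV_continuous S1 S2 S3 \<Psi>) \<and>
    (semi_uniform_Feller S1 S2 S3 \<Psi> \<longleftrightarrow> closed_set_condition S1 S2 S3 \<Psi>) \<and>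
    (semi_uniform_Feller S1 S2 S3 \<Psi> \<longleftrightarrow> continuity_set_condition S1 S2 S3 \<Psi>) \<and>
    (semi_uniform_Feller S1 S2 S3 \<Psi> \<longleftrightarrow> lower_semicontinuous_condition S1 S2 S3 \<Psi>) \<and>
    (semi_uniform_Feller S1 S2 S3 \<Psi> \<or> WTV_continuous S1 S2 S3 \<Psi> \<or>
      closed_set_condition S1 S2 S3 \<Psi> \<or> continuity_set_condition S1 S2 S3 \<Psi> \<or>
      lower_semicontinuous_condition S1 S2 S3 \<Psi> \<longrightarrow>
      continuous_in_total_variation S2 S3 (snd_marginal S2 \<Psi>))"
proof -
  interpret product_kernel S1 S2 S3 \<Psi> using assms(4) by unfold_locales
  note eqs = uniform_portmanteau.equivalences[OF portmanteau]
  have "semi_uniform_Feller S1 S2 S3 \<Psi> \<longleftrightarrow> WTV_continuous S1 S2 S3 \<Psi>"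
    using eqs(1) unfolding semi_uniform_Feller_iff WTV_continuous_iff by blast
  moreover have "semi_uniform_Feller S1 S2 S3 \<Psi> \<longleftrightarrow> closed_set_condition S1 S2 S3 \<Psi>"
    using eqs(2) unfolding semi_uniform_Feller_iff closed_set_condition_iff by blast
  moreover have "semi_uniform_Feller S1 S2 S3 \<Psi> \<longleftrightarrow> continuity_set_condition S1 S2 S3 \<Psi>"
    using eqs(3) unfolding semi_uniform_Feller_iff continuity_set_condition_iff by blast
  moreover have "semi_uniform_Feller S1 S2 S3 \<Psi> \<longleftrightarrow> lower_semicontinuous_condition S1 S2 S3 \<Psi>"
    using eqs(4) unfolding semi_uniform_Feller_iff lower_semicontinuous_condition_iff by blast
  moreover have "semi_uniform_Feller S1 S2 S3 \<Psi> \<longrightarrow> continuous_in_total_variation S2 S3 (snd_marginal S2 \<Psi>)"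
    using eqs(5) unfolding semi_uniform_Feller_iff continuous_in_total_variation_iff by blast
  ultimately show ?thesis by blast
qed

end
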